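(* Let $\mathcal{H}$ be a finite-dimensional Hilbert space, $|\phi_1\rangle,\dots,|\phi_K\rangle\in\mathcal{H}$ unit vectors, $\mathcal{H}_\Pi$ their span with orthogonal projector $\Pi$, and $\lambda_{\min}$ the minimum nonzero eigenvalue of $K^{-1}\sum_{k=1}^K|\phi_k\rangle\langle\phi_k|$. For a qubit $a$ let $R_a(k)=|0\rangle\langle0|_a\otimes I+|1\rangle\langle1|_a\otimes e^{i\pi|\phi_k\rangle\langle\phi_k|}$. Consider the procedure: (i) prepare qubits $a_1,\dots,a_T$ in $|-\rangle=(|0\rangle-|1\rangle)/\sqrt2$, choose $k_1,\dots,k_T$ independently and uniformly from $\{1,\dots,K\}$, and apply successively $R_{a_1}(k_1),\dots,R_{a_T}(k_T)$ (each to the system and the indicated qubit); (ii) perform the two-outcome measurement $\{|-\rangle\langle-|^{\otimes T},I-|-\rangle\langle-|^{\otimes T}\}$ on $a_1\cdots a_T$, where the first outcome is declared to correspond to $I-\Pi$ and the second to $\Pi$; (iii) apply successively $R_{a_T}(k_T),\dots,R_{a_1}(k_1)$. Let $\mathcal{E}$ be the channel describing the overall effect on the system when the measurement outcome is ignored. If the support of the system state $\rho$ is contained in $\mathcal{H}_\Pi$ or in its orthogonal complement, then the probability that the procedure outputs the outcome different from the one corresponding to that subspace is at most $(1-\lambda_{\min})^T$, and $F(\mathcal{E}(\rho),\rho)\ge1-(1-\lambda_{\min})^T$.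
   Context: $F(\sigma_1,\sigma_2)=\mathrm{Tr}\sqrt{\sqrt{\sigma_1}\sigma_2\sqrt{\sigma_1}}$ is the Uhlmann fidelity. $e^{i\pi|\phi\rangle\langle\phi|}=I-2|\phi\rangle\langle\phi|$. The controlled reflections are assumed perfect. *)

theory Defs
  imports "Jordan_Normal_Form.Schur_Decomposition" "Jordan_Normal_Form.Char_Poly"
begin

text \<open>Finite-dimensional Hilbert space = complex vectors of dimension n (JNF vec/mat).
  Composite systems a_1 ... a_T (qubits) and the system: index x*d + i with x < 2^T.\<close>

definition ctrace :: "complex mat \<Rightarrow> complex" where
  "ctrace A = (\<Sum>i<dim_row A. A $$ (i, i))"

definition kron :: "complex mat \<Rightarrow> complex mat \<Rightarrow> complex mat" where
  "kron A B = mat (dim_row A * dim_row B) (dim_col A * dim_col B)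
     (\<lambda>(i, j). A $$ (i div dim_row B, j div dim_col B) * B $$ (i mod dim_row B, j mod dim_col B))"

fun kpow :: "complex mat \<Rightarrow> nat \<Rightarrow> complex mat" where
  "kpow A 0 = 1\<^sub>m 1"
| "kpow A (Suc n) = kron A (kpow A n)"

definition outer :: "complex vec \<Rightarrow> complex vec \<Rightarrow> complex mat" where
  "outer v w = mat (dim_vec v) (dim_vec w) (\<lambda>(i, j). v $ i * cnj (w $ j))"

definition cinner :: "complex vec \<Rightarrow> complex vec \<Rightarrow> complex" where
  "cinner v w = conjugate v \<bullet> w"

definition unit_vec_c :: "nat \<Rightarrow> complex vec \<Rightarrow> bool" where
  "unit_vec_c n v \<longleftrightarrow> v \<in> carrier_vec n \<and> cinner v v = 1"

definition psd :: "nat \<Rightarrow> complex mat \<Rightarrow> bool" where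
  "psd n A \<longleftrightarrow> A \<in> carrier_mat n n \<and> mat_adjoint A = A \<and>
     (\<forall>v \<in> carrier_vec n. 0 \<le> Re (cinner v (A *\<^sub>v v)) \<and> Im (cinner v (A *\<^sub>v v)) = 0)"

definition density :: "nat \<Rightarrow> complex mat \<Rightarrow> bool" where
  "density n \<rho> \<longleftrightarrow> psd n \<rho> \<and> ctrace \<rho> = 1"

definition msqrt :: "complex mat \<Rightarrow> complex mat" where
  "msqrt A = (THE B. psd (dim_row A) B \<and> B * B = A)"

definition fidelity :: "complex mat \<Rightarrow> complex mat \<Rightarrow> real" where
  "fidelity s1 s2 = Re (ctrace (msqrt (msqrt s1 * s2 * msqrt s1)))"

definition supp :: "nat \<Rightarrow> complex mat \<Rightarrow> complex vec set" where
  "supp n A = {A *\<^sub>v v | v. v \<in> carrier_vec n}"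

definition cspan :: "nat \<Rightarrow> (nat \<Rightarrow> complex vec) \<Rightarrow> nat set \<Rightarrow> complex vec set" where
  "cspan n \<phi> I = {vec n (\<lambda>i. \<Sum>k\<in>I. c k * (\<phi> k $ i)) | c. True}"

definition orth_compl :: "nat \<Rightarrow> complex vec set \<Rightarrow> complex vec set" where
  "orth_compl n S = {v \<in> carrier_vec n. \<forall>w \<in> S. cinner w v = 0}"

definition avg_proj :: "nat \<Rightarrow> (nat \<Rightarrow> complex vec) \<Rightarrow> nat \<Rightarrow> complex mat" where
  "avg_proj d \<phi> K = mat d d (\<lambda>(i, j). (\<Sum>k\<in>{1..K}. outer (\<phi> k) (\<phi> k) $$ (i, j)) / of_nat K)"

definition lambda_min :: "complex mat \<Rightarrow> real" where
  "lambda_min A = Min {r :: real. r \<noteq> 0 \<and> eigenvalue A (complex_of_real r)}"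

text \<open>e^{i pi |phi><phi|} = I - 2|phi><phi|\<close>
definition refl :: "nat \<Rightarrow> complex vec \<Rightarrow> complex mat" where
  "refl d v = 1\<^sub>m d - 2 \<cdot>\<^sub>m outer v v"

definition ket0 :: "complex vec" where "ket0 = vec 2 (\<lambda>i. if i = 0 then 1 else 0)"
definition ket1 :: "complex vec" where "ket1 = vec 2 (\<lambda>i. if i = 0 then 0 else 1)"
definition ket_minus :: "complex vec" where
  "ket_minus = vec 2 (\<lambda>i. if i = 0 then 1 / complex_of_real (sqrt 2) else - 1 / complex_of_real (sqrt 2))"

text \<open>Operator A on qubit a_{j+1} (j < T) of T qubits (identity elsewhere).\<close>
definition qop :: "nat \<Rightarrow> nat \<Rightarrow> complex mat \<Rightarrow> complex mat" where
  "qop T j A = kron (kron (1\<^sub>m (2 ^ j)) A) (1\<^sub>m (2 ^ (T - j - 1)))"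

definition Rctl :: "nat \<Rightarrow> nat \<Rightarrow> (nat \<Rightarrow> complex vec) \<Rightarrow> nat \<Rightarrow> nat \<Rightarrow> complex mat" where
  "Rctl T d \<phi> j k = kron (qop T j (outer ket0 ket0)) (1\<^sub>m d) + kron (qop T j (outer ket1 ket1)) (refl d (\<phi> k))"

text \<open>Step (i): R_{a_T}(k_T) ... R_{a_1}(k_1) (R_{a_1} applied first);
  step (iii): R_{a_1}(k_1) ... R_{a_T}(k_T) (R_{a_T} applied first).\<close>
definition Ufwd :: "nat \<Rightarrow> nat \<Rightarrow> (nat \<Rightarrow> complex vec) \<Rightarrow> nat list \<Rightarrow> complex mat" where
  "Ufwd T d \<phi> ks = foldl (\<lambda>M j. Rctl T d \<phi> j (ks ! j) * M) (1\<^sub>m (2 ^ T * d)) [0..<T]"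

definition Ubwd :: "nat \<Rightarrow> nat \<Rightarrow> (nat \<Rightarrow> complex vec) \<Rightarrow> nat list \<Rightarrow> complex mat" where
  "Ubwd T d \<phi> ks = foldl (\<lambda>M j. Rctl T d \<phi> j (ks ! j) * M) (1\<^sub>m (2 ^ T * d)) (rev [0..<T])"

text \<open>Measurement operators: first outcome |-><-|^{(x)T} (declared I - Pi), second I - |-><-|^{(x)T} (declared Pi).\<close>
definition Meas1 :: "nat \<Rightarrow> nat \<Rightarrow> complex mat" where
  "Meas1 T d = kron (kpow (outer ket_minus ket_minus) T) (1\<^sub>m d)"

definition Meas2 :: "nat \<Rightarrow> nat \<Rightarrow> complex mat" where
  "Meas2 T d = 1\<^sub>m (2 ^ T * d) - Meas1 T d"

definition ptrace_anc :: "nat \<Rightarrow> nat \<Rightarrow> complex mat \<Rightarrow> complex mat" where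
  "ptrace_anc T d X = mat d d (\<lambda>(i, j). \<Sum>x<2 ^ T. X $$ (x * d + i, x * d + j))"

definition choices :: "nat \<Rightarrow> nat \<Rightarrow> nat list set" where
  "choices T K = {ks. length ks = T \<and> set ks \<subseteq> {1..K}}"

definition state_after_i :: "nat \<Rightarrow> nat \<Rightarrow> (nat \<Rightarrow> complex vec) \<Rightarrow> nat list \<Rightarrow> complex mat \<Rightarrow> complex mat" where
  "state_after_i T d \<phi> ks \<rho> =
     Ufwd T d \<phi> ks * kron (kpow (outer ket_minus ket_minus) T) \<rho> * mat_adjoint (Ufwd T d \<phi> ks)"

definition prob_out :: "nat \<Rightarrow> nat \<Rightarrow> nat \<Rightarrow> (nat \<Rightarrow> complex vec) \<Rightarrow> complex mat \<Rightarrow> complex mat \<Rightarrow> real" where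
  "prob_out T d K \<phi> M \<rho> =
     (\<Sum>ks\<in>choices T K. Re (ctrace (M * state_after_i T d \<phi> ks \<rho>))) / real K ^ T"

definition chan :: "nat \<Rightarrow> nat \<Rightarrow> nat \<Rightarrow> (nat \<Rightarrow> complex vec) \<Rightarrow> complex mat \<Rightarrow> complex mat" where
  "chan T d K \<phi> \<rho> = (1 / of_nat (K ^ T)) \<cdot>\<^sub>m
     mat d d (\<lambda>(i, j). \<Sum>ks\<in>choices T K.
       ptrace_anc T d (Ubwd T d \<phi> ks *
         (Meas1 T d * state_after_i T d \<phi> ks \<rho> * Meas1 T d
          + Meas2 T d * state_after_i T d \<phi> ks \<rho> * Meas2 T d)
         * mat_adjoint (Ubwd T d \<phi> ks)) $$ (i, j))"

end

theory Submission
  imports Defs "Jordan_Normal_Form.Spectral_Radius" "HOL-Analysis.L2_Norm"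
begin

text \<open>Let \<open>V = |->\<^sup>\<otimes>\<^sup>T \<otimes> I\<close>. On \<open>|->\<close> a controlled reflection acts as \<open>|->(I - P\<^sub>k) + |+>P\<^sub>k\<close>, so
  \<open>L = V\<^sup>* U V = (I - P\<^sub>k\<^sub>T) \<dots> (I - P\<^sub>k\<^sub>1)\<close> for the circuit \<open>U\<close> of step (i), and the first outcome has
  probability \<open>tr (L\<^sup>*L \<rho>)\<close> averaged over the choices. On the span of the \<open>\<phi>\<^sub>k\<close> each averaged step shrinks
  \<open>\<parallel>v\<parallel>\<^sup>2\<close> by a factor \<open>1 - \<lambda>\<^sub>m\<^sub>i\<^sub>n\<close>; on the orthogonal complement \<open>L\<close> is the identity.

  For the fidelity, keep from the Kraus operators of the channel only those that leave the ancillas in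
  \<open>|->\<^sup>\<otimes>\<^sup>T\<close>: \<open>L\<^sup>*L\<close> (first outcome) and \<open>I - L\<^sup>*L\<close> (second outcome). Hence \<open>E \<rho> \<ge> B \<rho> B\<close> with \<open>B\<close> the
  average of either of them, and \<open>B \<rho> B \<le> \<sigma>\<close> implies \<open>tr (B \<rho>) \<le> F(\<sigma>, \<rho>)\<close>.\<close>

subsection \<open>Complex matrices and vectors\<close>

text \<open>Two losses stand behind the domination by an averaged operator: discarding Kraus
  operators, and replacing the average of the single terms by one term built from the average. Both
  are instances of the Cauchy-Schwarz inequality \<open>cmod_sum_mult_le\<close>. Which outcome is
  worth keeping depends on the subspace: its operator must have expectation close to 1 in
  \<open>\<rho>\<close>, so it is the one of the outcome declared for that subspace. That the second
  outcome contributes the complement of the first rests on step (iii) being the exact inverse of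
  step (i), because the gates are self-adjoint involutions. The fidelity bound is a statement about
  operators, linear in a trace, so mixed states are treated directly, without purifications or
  concavity of the fidelity. \<open>msqrt\<close> is a definite description and says nothing before
  existence and uniqueness of positive roots are known; hence the spectral theorem comes first.
  Since \<open>\<sigma>\<close> may be singular, the contraction behind the bound is built from a
  generalised inverse.\<close>

lemma dim_mat_adjoint [simp]:
  "dim_row (mat_adjoint A) = dim_col A" "dim_col (mat_adjoint A) = dim_row A"
  by (auto simp: mat_adjoint_def)

lemma index_mat_adjoint [simp]:
  "i < dim_col A \<Longrightarrow> j < dim_row A \<Longrightarrow> mat_adjoint A $$ (i, j) = cnj (A $$ (j, i))"
  by (simp add: mat_adjoint_def mat_of_rows_def)

lemma mat_adjoint_carrier [simp]:
  "A \<in> carrier_mat n m \<Longrightarrow> mat_adjoint A \<in> carrier_mat m n"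
  by (auto intro: carrier_matI)

lemma mat_adjoint_adjoint [simp]: "mat_adjoint (mat_adjoint A) = (A :: complex mat)"
  by (rule eq_matI) auto

lemma mult_mat_index_sum:
  "i < dim_row A \<Longrightarrow> j < dim_col B \<Longrightarrow> dim_col A = dim_row B \<Longrightarrow>
    (A * B) $$ (i, j) = (\<Sum>k<dim_row B. A $$ (i, k) * B $$ (k, j))"
  by (auto simp: scalar_prod_def atLeast0LessThan intro!: sum.cong)

lemma mult_mat_vec_index_sum:
  "i < dim_row A \<Longrightarrow> dim_col A = dim_vec v \<Longrightarrow>
    (A *\<^sub>v v) $ i = (\<Sum>k<dim_vec v. A $$ (i, k) * v $ k)"
  by (auto simp: scalar_prod_def atLeast0LessThan intro!: sum.cong)

lemma mat_adjoint_mult: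
  "dim_col A = dim_row B \<Longrightarrow> mat_adjoint (A * B) = mat_adjoint B * mat_adjoint (A :: complex mat)"
  by (rule eq_matI) (auto simp: mult_mat_index_sum mult.commute simp del: index_mult_mat(1))

lemma mat_adjoint_add:
  "dim_row A = dim_row B \<Longrightarrow> dim_col A = dim_col B \<Longrightarrow>
    mat_adjoint (A + B) = mat_adjoint A + mat_adjoint (B :: complex mat)"
  by (rule eq_matI) auto

lemma mat_adjoint_minus:
  "dim_row A = dim_row B \<Longrightarrow> dim_col A = dim_col B \<Longrightarrow>
    mat_adjoint (A - B) = mat_adjoint A - mat_adjoint (B :: complex mat)"
  by (rule eq_matI) auto

lemma mat_adjoint_smult: "mat_adjoint (c \<cdot>\<^sub>m A) = cnj c \<cdot>\<^sub>m mat_adjoint A"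
  by (rule eq_matI) auto

lemma mat_adjoint_one [simp]: "mat_adjoint (1\<^sub>m n :: complex mat) = 1\<^sub>m n"
  by (rule eq_matI) auto

text \<open>Unlike the library versions, these rewrite without having to guess intermediate dimensions.\<close>

lemma mult_assoc_dim:
  "dim_col A = dim_row B \<Longrightarrow> dim_col B = dim_row C \<Longrightarrow> A * B * C = A * (B * (C :: complex mat))"
  by (rule assoc_mult_mat[of _ "dim_row A" "dim_col A" _ "dim_row C" _ "dim_col C"])
    (auto intro: carrier_matI)

lemma mult_vec_assoc_dim:
  "dim_col A = dim_row B \<Longrightarrow> dim_col B = dim_vec v \<Longrightarrow> (A * B) *\<^sub>v v = A *\<^sub>v (B *\<^sub>v (v :: complex vec))"
  by (rule assoc_mult_mat_vec[of _ "dim_row A" "dim_col A" _ "dim_vec v"])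
    (auto intro: carrier_matI carrier_vecI)

lemma cinner_sum: "dim_vec v = dim_vec w \<Longrightarrow> cinner v w = (\<Sum>i<dim_vec w. cnj (v $ i) * w $ i)"
  by (auto simp: cinner_def scalar_prod_def atLeast0LessThan intro!: sum.cong)

lemma cinner_mult_mat_vec:
  assumes "dim_row A = dim_vec v" "dim_col A = dim_vec w"
  shows "cinner v (A *\<^sub>v w) = cinner (mat_adjoint A *\<^sub>v v) w"
proof -
  have "cinner v (A *\<^sub>v w) = (\<Sum>i<dim_vec v. \<Sum>k<dim_vec w. cnj (v $ i) * (A $$ (i, k) * w $ k))"
    using assms by (auto simp: cinner_sum mult_mat_vec_index_sum sum_distrib_left simp del: index_mult_mat_vec)
  also have "\<dots> = (\<Sum>k<dim_vec w. \<Sum>i<dim_vec v. cnj (v $ i) * (A $$ (i, k) * w $ k))"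
    by (rule sum.swap)
  also have "\<dots> = cinner (mat_adjoint A *\<^sub>v v) w"
    using assms by (auto simp: cinner_sum mult_mat_vec_index_sum sum_distrib_left sum_distrib_right
        mult_ac simp del: index_mult_mat_vec intro!: sum.cong)
  finally show ?thesis .
qed

definition vnorm2 :: "complex vec \<Rightarrow> real" where
  "vnorm2 v = (\<Sum>i<dim_vec v. (cmod (v $ i))\<^sup>2)"

lemma cinner_self: "cinner v v = complex_of_real (vnorm2 v)"
  unfolding cinner_sum[OF refl] vnorm2_def of_real_sum
  by (rule sum.cong) (auto simp: complex_norm_square mult.commute simp del: of_real_power)

lemma vnorm2_nonneg [simp]: "0 \<le> vnorm2 v"
  by (simp add: vnorm2_def sum_nonneg)

lemma vnorm2_eq_0_iff: "vnorm2 v = 0 \<longleftrightarrow> v = 0\<^sub>v (dim_vec v)"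
proof
  assume "vnorm2 v = 0"
  then show "v = 0\<^sub>v (dim_vec v)" by (intro eq_vecI) (auto simp: vnorm2_def sum_nonneg_eq_0_iff)
next
  assume v: "v = 0\<^sub>v (dim_vec v)"
  show "vnorm2 v = 0" unfolding vnorm2_def by (subst v) (simp add: sum.neutral)
qed

lemma vnorm2_mult_mat_vec:
  "dim_col A = dim_vec v \<Longrightarrow> vnorm2 (A *\<^sub>v v) = Re (cinner v ((mat_adjoint A * A) *\<^sub>v v))"
proof -
  assume "dim_col A = dim_vec v"
  then have "cinner v ((mat_adjoint A * A) *\<^sub>v v) = cinner (A *\<^sub>v v) (A *\<^sub>v v)"
    by (simp add: mult_vec_assoc_dim cinner_mult_mat_vec)
  then show ?thesis by (simp add: cinner_self)
qed

lemma cinner_Cauchy_Schwarz: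
  assumes "dim_vec v = dim_vec w"
  shows "cmod (cinner v w) \<le> sqrt (vnorm2 v) * sqrt (vnorm2 w)"
proof -
  have "cmod (cinner v w) \<le> (\<Sum>i<dim_vec w. \<bar>cmod (v $ i)\<bar> * \<bar>cmod (w $ i)\<bar>)"
    unfolding cinner_sum[OF assms] by (rule order_trans[OF norm_sum]) (simp add: norm_mult)
  also have "\<dots> \<le> L2_set (\<lambda>i. cmod (v $ i)) {..<dim_vec w} * L2_set (\<lambda>i. cmod (w $ i)) {..<dim_vec w}"
    by (rule L2_set_mult_ineq)
  finally show ?thesis using assms by (simp add: L2_set_def vnorm2_def)
qed

lemma cinner_commute: "dim_vec v = dim_vec w \<Longrightarrow> cinner v w = cnj (cinner w v)"
  by (simp add: cinner_sum mult.commute)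

lemma cinner_smult_right: "dim_vec v = dim_vec w \<Longrightarrow> cinner v (c \<cdot>\<^sub>v w) = c * cinner v w"
  by (auto simp: cinner_sum sum_distrib_left intro!: sum.cong)

lemma cinner_add_right:
  "dim_vec v = dim_vec w \<Longrightarrow> dim_vec u = dim_vec w \<Longrightarrow> cinner v (u + w) = cinner v u + cinner v w"
  by (auto simp: cinner_sum sum.distrib distrib_left)

lemma cinner_diff_right:
  "dim_vec v = dim_vec w \<Longrightarrow> dim_vec u = dim_vec w \<Longrightarrow> cinner v (u - w) = cinner v u - cinner v w"
  by (auto simp: cinner_sum sum_subtractf right_diff_distrib)

lemma cinner_self_eq_0: "cinner v v = 0 \<longleftrightarrow> v = 0\<^sub>v (dim_vec v)"
  by (simp add: cinner_self vnorm2_eq_0_iff)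

lemma ctrace_cyclic:
  assumes "dim_col A = dim_row B" "dim_col B = dim_row A"
  shows "ctrace (A * B) = ctrace (B * A)"
proof -
  have "ctrace (A * B) = (\<Sum>i<dim_row A. \<Sum>k<dim_row B. A $$ (i, k) * B $$ (k, i))"
    using assms by (auto simp: ctrace_def mult_mat_index_sum simp del: index_mult_mat(1))
  also have "\<dots> = (\<Sum>k<dim_row B. \<Sum>i<dim_row A. A $$ (i, k) * B $$ (k, i))"
    by (rule sum.swap)
  also have "\<dots> = ctrace (B * A)"
    using assms by (auto simp: ctrace_def mult_mat_index_sum mult.commute simp del: index_mult_mat(1))
  finally show ?thesis .
qed

lemma ctrace_minus:
  "dim_row A = dim_row B \<Longrightarrow> dim_col B = dim_row B \<Longrightarrow> ctrace (A - B) = ctrace A - ctrace B"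
  by (simp add: ctrace_def sum_subtractf)

lemma ctrace_adjoint: "dim_row A = dim_col A \<Longrightarrow> ctrace (mat_adjoint A) = cnj (ctrace A)"
  by (simp add: ctrace_def)

subsection \<open>Unitary diagonalisation\<close>

definition real_diag :: "nat \<Rightarrow> (nat \<Rightarrow> real) \<Rightarrow> complex mat" where
  "real_diag n r = mat n n (\<lambda>(i, j). if i = j then complex_of_real (r i) else 0)"

definition unitary :: "nat \<Rightarrow> complex mat \<Rightarrow> bool" where
  "unitary n U \<longleftrightarrow> U \<in> carrier_mat n n \<and> mat_adjoint U * U = 1\<^sub>m n \<and> U * mat_adjoint U = 1\<^sub>m n"

lemma unitaryI:
  "U \<in> carrier_mat n n \<Longrightarrow> mat_adjoint U * U = 1\<^sub>m n \<Longrightarrow> unitary n U"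
  unfolding unitary_def by (auto intro: mat_mult_left_right_inverse)

lemma unitary_carrier [simp]: "unitary n U \<Longrightarrow> U \<in> carrier_mat n n"
  by (simp add: unitary_def)

lemma unitary_mult: "unitary n U \<Longrightarrow> unitary n V \<Longrightarrow> unitary n (U * V)"
proof (rule unitaryI)
  assume U: "unitary n U" and V: "unitary n V"
  then have [simp]: "dim_row U = n" "dim_col U = n" "dim_row V = n" "dim_col V = n"
    by (auto simp: unitary_def)
  have "mat_adjoint (U * V) * (U * V) = mat_adjoint V * ((mat_adjoint U * U) * V)"
    by (simp add: mat_adjoint_mult mult_assoc_dim)
  also have "\<dots> = 1\<^sub>m n" using U V by (simp add: unitary_def)
  finally show "mat_adjoint (U * V) * (U * V) = 1\<^sub>m n" .
qed (auto simp: unitary_def)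

text \<open>Makes an eigenvector the first column of a unitary, the deflation step of the
  diagonalisation. Gram-Schmidt on a basis completing \<open>v\<close> keeps \<open>v\<close> in
  front; the scalar \<open>c\<close> is the normalising factor.\<close>

lemma unitary_with_first_column:
  assumes v: "v \<in> carrier_vec n" and v0: "v \<noteq> 0\<^sub>v n"
  obtains U c where "unitary n U" "0 < n" "col U 0 = c \<cdot>\<^sub>v v"
proof -
  interpret cof_vec_space n "TYPE(complex)" .
  define ws where "ws = gram_schmidt n (basis_completion v)"
  note bc = basis_completion[OF v v0]
  note gs = gram_schmidt_result[OF bc(2) bc(4) bc(5) ws_def]
  have n: "0 < n" using v v0 by (cases n) (auto intro!: eq_vecI)
  have len: "length ws = n" using gs(4) bc(6) by simp
  have "hd ws = v" unfolding ws_def basis_completion_def Let_def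
    using v by (subst gram_schmidt_hd) auto
  then have ws0: "ws ! 0 = v" using len n by (simp add: hd_conv_nth flip: length_greater_0_conv)
  have wsc: "ws ! i \<in> carrier_vec n" if "i < n" for i using gs(3) len that by auto
  have wdim[simp]: "dim_vec (ws ! i) = n" if "i < n" for i using wsc[OF that] by auto
  \<comment> \<open>Here \<open>\<bullet>c\<close> conjugates the second vector and
    \<open>cinner\<close> the first, so the two products differ by a swap of arguments. The
    equivalence also yields nonzero norms, which the scaling below requires.\<close>
  have orth: "cinner (ws ! i) (ws ! j) = 0 \<longleftrightarrow> i \<noteq> j" if "i < n" "j < n" for i j
  proof -
    have "cinner (ws ! i) (ws ! j) = ws ! j \<bullet>c ws ! i"
      unfolding cinner_def by (rule comm_scalar_prod[of _ n]) (auto simp: wsc that)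
    then show ?thesis using corthogonalD[OF gs(2), of j i] len that by auto
  qed
  \<comment> \<open>The Gram-Schmidt vectors are orthogonal but not of unit length; the columns are
    normalised here.\<close>
  define U where "U = mat n n (\<lambda>(i, j). complex_of_real (1 / sqrt (vnorm2 (ws ! j))) * ws ! j $ i)"
  have U: "U \<in> carrier_mat n n" by (simp add: U_def)
  have "mat_adjoint U * U = 1\<^sub>m n"
  proof (rule eq_matI)
    fix i j assume ij: "i < dim_row (1\<^sub>m n :: complex mat)" "j < dim_col (1\<^sub>m n :: complex mat)"
    then have "(mat_adjoint U * U) $$ (i, j)
      = (\<Sum>k<n. complex_of_real (1 / sqrt (vnorm2 (ws ! i)) * (1 / sqrt (vnorm2 (ws ! j)))) *
           (cnj (ws ! i $ k) * ws ! j $ k))"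
      by (simp add: U_def mult_mat_index_sum mult_ac del: index_mult_mat(1))
    also have "\<dots> = complex_of_real (1 / sqrt (vnorm2 (ws ! i)) * (1 / sqrt (vnorm2 (ws ! j)))) *
        cinner (ws ! i) (ws ! j)"
      using ij by (simp add: cinner_sum sum_distrib_left)
    also have "\<dots> = 1\<^sub>m n $$ (i, j)"
    proof (cases "i = j")
      case True
      have "vnorm2 (ws ! i) \<noteq> 0" using orth[of i i] ij by (simp add: cinner_self)
      then have "vnorm2 (ws ! i) > 0" using vnorm2_nonneg[of "ws ! i"] by linarith
      then show ?thesis using True ij by (simp add: cinner_self flip: of_real_mult)
    qed (use orth ij in auto)
    finally show "(mat_adjoint U * U) $$ (i, j) = 1\<^sub>m n $$ (i, j)" .
  qed (auto simp: U_def)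
  then have "unitary n U" using U by (rule unitaryI[rotated])
  moreover have "col U 0 = complex_of_real (1 / sqrt (vnorm2 v)) \<cdot>\<^sub>v v"
    using n v by (intro eq_vecI) (auto simp: U_def ws0)
  ultimately show thesis using n by (intro that)
qed

text \<open>The block-diagonal matrix with blocks \<open>a\<close> and \<open>A\<close>: one
  split-off eigenvalue next to the remaining \<open>n\<close>-dimensional problem.\<close>

definition border :: "nat \<Rightarrow> complex \<Rightarrow> complex mat \<Rightarrow> complex mat" where
  "border n a A = mat (Suc n) (Suc n)
    (\<lambda>(i, j). if i = 0 \<and> j = 0 then a else if i = 0 \<or> j = 0 then 0 else A $$ (i - 1, j - 1))"

lemma dim_border [simp]: "dim_row (border n a A) = Suc n" "dim_col (border n a A) = Suc n"
  by (auto simp: border_def)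

lemma border_adjoint:
  "dim_row A = n \<Longrightarrow> dim_col A = n \<Longrightarrow> mat_adjoint (border n a A) = border n (cnj a) (mat_adjoint A)"
  by (rule eq_matI) (auto simp: border_def)

lemma border_mult:
  assumes "dim_row A = n" "dim_col A = n" "dim_row B = n" "dim_col B = n"
  shows "border n a A * border n b B = border n (a * b) (A * B)"
proof (rule eq_matI)
  fix i j assume "i < dim_row (border n (a * b) (A * B))" "j < dim_col (border n (a * b) (A * B))"
  then have ij: "i < Suc n" "j < Suc n" by auto
  have "(border n a A * border n b B) $$ (i, j) =
      border n a A $$ (i, 0) * border n b B $$ (0, j) +
      (\<Sum>k<n. border n a A $$ (i, Suc k) * border n b B $$ (Suc k, j))"
    using ij by (simp add: mult_mat_index_sum sum.lessThan_Suc_shift del: index_mult_mat(1) sum.lessThan_Suc)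
  also have "\<dots> = border n (a * b) (A * B) $$ (i, j)"
    using ij assms by (cases i; cases j)
      (simp_all add: border_def mult_mat_index_sum del: index_mult_mat(1))
  finally show "(border n a A * border n b B) $$ (i, j) = border n (a * b) (A * B) $$ (i, j)" .
qed auto

text \<open>Deflation. In a unitary basis that starts with an eigenvector, the first column is a
  multiple of the first basis vector, Hermiticity gives the same for the first row, and the
  remaining block is a smaller Hermitian matrix.\<close>

theorem hermitian_diagonalisation:
  assumes "A \<in> carrier_mat n n" "mat_adjoint A = A"
  obtains U r where "unitary n U" "A = U * real_diag n r * mat_adjoint U"
proof -
  \<comment> \<open>The induction runs on the conjugated form, in which the unitaries
    \<open>W\<close> and \<open>V\<close> of one step compose to \<open>W * V\<close>.\<close>
  have "\<exists>U r. unitary n U \<and> mat_adjoint U * A * U = real_diag n r"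
    using assms
  proof (induction n arbitrary: A)
    case 0
    then have "unitary 0 (1\<^sub>m 0)" "mat_adjoint (1\<^sub>m 0) * A * 1\<^sub>m 0 = real_diag 0 (\<lambda>_. 0)"
      by (auto intro!: unitaryI eq_matI simp: real_diag_def)
    then show ?case by blast
  next
    case (Suc n)
    have [simp]: "dim_row A = Suc n" "dim_col A = Suc n" using Suc.prems by auto
    obtain e where "eigenvalue A e" using spectrum_non_empty[OF Suc.prems(1)] by (auto simp: spectrum_def)
    then obtain v where v: "v \<in> carrier_vec (Suc n)" "v \<noteq> 0\<^sub>v (Suc n)" and Av: "A *\<^sub>v v = e \<cdot>\<^sub>v v"
      by (auto simp: eigenvalue_def eigenvector_def)
    obtain W c where W: "unitary (Suc n) W" and W0: "col W 0 = c \<cdot>\<^sub>v v"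
      using unitary_with_first_column[OF v] by metis
    have [simp]: "dim_row W = Suc n" "dim_col W = Suc n" using unitary_carrier[OF W] by auto
    define B where "B = mat_adjoint W * A * W"
    have [simp]: "dim_row B = Suc n" "dim_col B = Suc n" by (auto simp: B_def)
    have Bh: "mat_adjoint B = B" using Suc.prems by (simp add: B_def mat_adjoint_mult mult_assoc_dim)
    have Bsym: "B $$ (i, j) = cnj (B $$ (j, i))" if "i < Suc n" "j < Suc n" for i j
      using that by (subst Bh[symmetric]) simp
    have Bcol: "B $$ (i, 0) = (if i = 0 then e else 0)" if i: "i < Suc n" for i
    proof -
      have "col B 0 = (mat_adjoint W * A) *\<^sub>v col W 0"
        unfolding B_def by (rule col_mult2) (auto intro: carrier_matI)
      also have "\<dots> = mat_adjoint W *\<^sub>v (e \<cdot>\<^sub>v col W 0)"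
        using v Av by (simp add: mult_vec_assoc_dim W0 mult_mat_vec[OF Suc.prems(1)] smult_smult_assoc mult.commute)
      also have "\<dots> = e \<cdot>\<^sub>v (mat_adjoint W *\<^sub>v col W 0)"
        by (rule mult_mat_vec) (auto simp: carrier_matI carrier_vecI)
      also have "mat_adjoint W *\<^sub>v col W 0 = col (mat_adjoint W * W) 0"
        by (rule col_mult2[symmetric]) (auto intro: carrier_matI)
      finally have *: "col B 0 = e \<cdot>\<^sub>v col (1\<^sub>m (Suc n)) 0" using W by (simp add: unitary_def)
      have "B $$ (i, 0) = col B 0 $ i" using i by simp
      then show ?thesis using i unfolding * by simp
    qed
    \<comment> \<open>A diagonal entry of a Hermitian matrix is real, and \<open>e\<close> is the
      corner entry of \<open>B\<close>.\<close>
    have e_real: "e = complex_of_real (Re e)"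
      using Bsym[of 0 0] Bcol[of 0] by (simp add: complex_eq_iff)
    then have e_cnj: "cnj e = e" by (metis complex_cnj_complex_of_real)
    define A' where "A' = mat n n (\<lambda>(i, j). B $$ (Suc i, Suc j))"
    have "A' \<in> carrier_mat n n" "mat_adjoint A' = A'"
      by (auto simp: A'_def intro!: eq_matI) (auto intro: Bsym[symmetric])
    from Suc.IH[OF this] obtain U r where U: "unitary n U" and Ur: "mat_adjoint U * A' * U = real_diag n r"
      by blast
    have [simp]: "dim_row U = n" "dim_col U = n" using unitary_carrier[OF U] by auto
    define V where "V = border n 1 U"
    have [simp]: "dim_row V = Suc n" "dim_col V = Suc n" by (auto simp: V_def)
    have Vadj: "mat_adjoint V = border n 1 (mat_adjoint U)"
      by (simp add: V_def border_adjoint)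
    have Beq: "B = border n e A'"
      using Bcol Bsym[of 0] by (intro eq_matI) (auto simp: A'_def border_def e_cnj)
    have [simp]: "dim_row A' = n" "dim_col A' = n" by (auto simp: A'_def)
    have "mat_adjoint V * V = border n 1 (mat_adjoint U * U)"
      unfolding Vadj by (simp add: V_def border_mult)
    also have "\<dots> = 1\<^sub>m (Suc n)" using U by (auto simp: unitary_def border_def intro!: eq_matI)
    finally have V: "unitary (Suc n) V" by (intro unitaryI) (auto simp: carrier_matI)
    have "mat_adjoint V * B * V = border n e (mat_adjoint U * A' * U)"
      unfolding Vadj Beq by (simp add: V_def border_mult)
    \<comment> \<open>Index 0 carries the new eigenvalue, so the old ones move up by one.\<close>
    also have "\<dots> = real_diag (Suc n) (\<lambda>i. if i = 0 then Re e else r (i - 1))"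
      unfolding Ur using e_real by (intro eq_matI) (auto simp: real_diag_def border_def)
    finally have "mat_adjoint (W * V) * A * (W * V) = real_diag (Suc n) (\<lambda>i. if i = 0 then Re e else r (i - 1))"
      by (simp add: B_def mat_adjoint_mult mult_assoc_dim)
    then show ?case using unitary_mult[OF W V] by blast
  qed
  then obtain U r where U: "unitary n U" and r: "mat_adjoint U * A * U = real_diag n r" by blast
  have [simp]: "dim_row U = n" "dim_col U = n" "dim_row A = n" "dim_col A = n"
    using unitary_carrier[OF U] assms by auto
  have "U * real_diag n r * mat_adjoint U = (U * mat_adjoint U) * A * (U * mat_adjoint U)"
    unfolding r[symmetric] by (simp add: mult_assoc_dim)
  then have "A = U * real_diag n r * mat_adjoint U" using U assms by (simp add: unitary_def)
  with U show thesis by (rule that)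
qed


section \<open>Functional calculus in a fixed eigenbasis\<close>

lemma dim_real_diag [simp]: "dim_row (real_diag n r) = n" "dim_col (real_diag n r) = n"
  by (auto simp: real_diag_def)

lemma real_diag_mult_vec:
  "v \<in> carrier_vec n \<Longrightarrow> real_diag n r *\<^sub>v v = vec n (\<lambda>i. complex_of_real (r i) * v $ i)"
  by (rule eq_vecI)
    (auto simp: real_diag_def mult_mat_vec_index_sum if_distrib[of "\<lambda>x. x * _"] sum.delta cong: if_cong
       simp del: index_mult_mat_vec)

lemma real_diag_mult: "real_diag n r * real_diag n s = real_diag n (\<lambda>i. r i * s i)"
  by (rule eq_matI)
    (auto simp: real_diag_def mult_mat_index_sum if_distrib[of "\<lambda>x. x * _"] sum.delta cong: if_cong
       simp del: index_mult_mat(1))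

lemma real_diag_adjoint [simp]: "mat_adjoint (real_diag n r) = real_diag n r"
  by (rule eq_matI) (auto simp: real_diag_def)

text \<open>Functions of one Hermitian matrix share \<open>U\<close> and differ only in
  \<open>r\<close>, so products become pointwise. Square roots, generalised inverses and range
  projectors are all of this form.\<close>

definition spectral_mat :: "nat \<Rightarrow> complex mat \<Rightarrow> (nat \<Rightarrow> real) \<Rightarrow> complex mat" where
  "spectral_mat n U r = U * real_diag n r * mat_adjoint U"

context
  fixes n :: nat and U :: "complex mat"
  assumes U: "unitary n U"
begin

lemma dim_unitary: "dim_row U = n" "dim_col U = n"
  using unitary_carrier[OF U] by auto

lemma dim_spectral_mat: "dim_row (spectral_mat n U r) = n" "dim_col (spectral_mat n U r) = n"
  by (auto simp: spectral_mat_def dim_unitary)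

text \<open>Stated for right-nested products: \<open>mult_assoc_dim\<close> normalises to that
  shape, in which the factor \<open>mat_adjoint U * U\<close> no longer occurs literally.\<close>

lemma unitary_cancel:
  "dim_row A = n \<Longrightarrow> mat_adjoint U * (U * A) = A" "dim_row A = n \<Longrightarrow> U * (mat_adjoint U * A) = A"
proof -
  assume A: "dim_row A = n"
  have "mat_adjoint U * (U * A) = mat_adjoint U * U * A" "U * (mat_adjoint U * A) = U * mat_adjoint U * A"
    using A by (simp_all add: mult_assoc_dim dim_unitary)
  then show "mat_adjoint U * (U * A) = A" "U * (mat_adjoint U * A) = A"
    using U A by (simp_all add: unitary_def)
qed

lemma spectral_mat_mult: "spectral_mat n U r * spectral_mat n U s = spectral_mat n U (\<lambda>i. r i * s i)"
  by (simp add: spectral_mat_def mult_assoc_dim dim_unitary unitary_cancel flip: real_diag_mult)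

lemma spectral_mat_adjoint: "mat_adjoint (spectral_mat n U r) = spectral_mat n U r"
  by (simp add: spectral_mat_def mult_assoc_dim dim_unitary mat_adjoint_mult)

lemma unitary_coord: "v \<in> carrier_vec n \<Longrightarrow> i < n \<Longrightarrow> (mat_adjoint U *\<^sub>v v) $ i = cinner (col U i) v"
  by (auto simp: mult_mat_vec_index_sum cinner_sum dim_unitary simp del: index_mult_mat_vec intro!: sum.cong)

lemma parseval: "v \<in> carrier_vec n \<Longrightarrow> vnorm2 v = (\<Sum>i<n. (cmod (cinner (col U i) v))\<^sup>2)"
proof -
  assume v: "v \<in> carrier_vec n"
  then have "vnorm2 (mat_adjoint U *\<^sub>v v) = vnorm2 v"
    using U by (subst vnorm2_mult_mat_vec) (auto simp: dim_unitary unitary_def cinner_self)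
  then show ?thesis by (simp add: vnorm2_def[of "_ *\<^sub>v _"] unitary_coord v dim_unitary del: index_mult_mat_vec)
qed

lemma cinner_spectral_mat:
  assumes "v \<in> carrier_vec n"
  shows "cinner v (spectral_mat n U r *\<^sub>v v) = complex_of_real (\<Sum>i<n. r i * (cmod (cinner (col U i) v))\<^sup>2)"
proof -
  let ?w = "mat_adjoint U *\<^sub>v v"
  have w: "?w \<in> carrier_vec n" by (simp add: dim_unitary carrier_vecI)
  have "cinner v (spectral_mat n U r *\<^sub>v v) = cinner ?w (real_diag n r *\<^sub>v ?w)"
    using assms by (simp add: spectral_mat_def mult_vec_assoc_dim dim_unitary cinner_mult_mat_vec)
  also have "\<dots> = (\<Sum>i<n. cnj (?w $ i) * (complex_of_real (r i) * ?w $ i))"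
    unfolding real_diag_mult_vec[OF w] using w by (simp add: cinner_sum dim_unitary del: index_mult_mat_vec)
  also have "\<dots> = complex_of_real (\<Sum>i<n. r i * (cmod (cinner (col U i) v))\<^sup>2)"
    unfolding of_real_sum
    by (rule sum.cong) (auto simp: unitary_coord assms complex_norm_square mult_ac
        simp del: of_real_power index_mult_mat_vec)
  finally show ?thesis .
qed

lemma cinner_col_unitary: "i < n \<Longrightarrow> j < n \<Longrightarrow> cinner (col U i) (col U j) = (if i = j then 1 else 0)"
proof -
  assume ij: "i < n" "j < n"
  then have "cinner (col U i) (col U j) = (mat_adjoint U * U) $$ (i, j)"
    by (simp add: cinner_sum mult_mat_index_sum dim_unitary del: index_mult_mat(1))
  then show ?thesis using U ij by (simp add: unitary_def)
qed

lemma cinner_spectral_mat_col: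
  assumes "i < n"
  shows "cinner (col U i) (spectral_mat n U r *\<^sub>v col U i) = complex_of_real (r i)"
proof -
  have "(\<Sum>j<n. r j * (cmod (cinner (col U j) (col U i)))\<^sup>2) = (\<Sum>j<n. if j = i then r j else 0)"
    using assms by (intro sum.cong) (auto simp: cinner_col_unitary)
  then show ?thesis
    using assms by (subst cinner_spectral_mat) (auto simp: dim_unitary carrier_vecI)
qed

lemma spectral_mat_mult_unitary: "spectral_mat n U r * U = U * real_diag n r"
  using U by (simp add: spectral_mat_def mult_assoc_dim dim_unitary) (simp add: unitary_def mult_assoc_dim)

lemma spectral_mat_eigen:
  assumes "i < n"
  shows "spectral_mat n U r *\<^sub>v col U i = complex_of_real (r i) \<cdot>\<^sub>v col U i"
proof -
  have "spectral_mat n U r *\<^sub>v col U i = col (spectral_mat n U r * U) i"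
    using assms by (intro col_mult2[symmetric]) (auto simp: carrier_matI dim_unitary dim_spectral_mat)
  also have "\<dots> = complex_of_real (r i) \<cdot>\<^sub>v col U i"
    unfolding spectral_mat_mult_unitary using assms
    by (intro eq_vecI)
      (auto simp: dim_unitary mult_mat_index_sum real_diag_def if_distrib[of "\<lambda>x. _ * x"] sum.delta
        cong: if_cong simp del: index_mult_mat(1))
  finally show ?thesis .
qed

text \<open>Conjugation by \<open>U\<close> preserves the trace by cyclicity, and the diagonal of
  \<open>mat_adjoint U * A * U\<close> consists of these expectations.\<close>

lemma ctrace_eq_sum_cinner:
  assumes "A \<in> carrier_mat n n"
  shows "ctrace A = (\<Sum>i<n. cinner (col U i) (A *\<^sub>v col U i))"
proof -
  have dA: "dim_row A = n" "dim_col A = n" using assms by auto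
  have "ctrace A = ctrace (U * (mat_adjoint U * A))" using dA by (simp add: unitary_cancel)
  also have "\<dots> = ctrace (mat_adjoint U * A * U)"
    using dA by (simp add: ctrace_cyclic[of U] dim_unitary)
  also have "\<dots> = (\<Sum>i<n. cinner (col U i) (A *\<^sub>v col U i))"
    unfolding ctrace_def
  proof (intro sum.cong)
    fix i assume "i \<in> {..<n}"
    then have i: "i < n" by simp
    have "col (A * U) i = A *\<^sub>v col U i"
      using i by (intro col_mult2) (auto simp: dA dim_unitary carrier_matI)
    then have "(mat_adjoint U * A * U) $$ (i, i) = row (mat_adjoint U) i \<bullet> (A *\<^sub>v col U i)"
      using i dA by (simp add: mult_assoc_dim dim_unitary)
    also have "row (mat_adjoint U) i = conjugate (col U i)"
      using i by (intro eq_vecI) (auto simp: dim_unitary)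
    finally show "(mat_adjoint U * A * U) $$ (i, i) = cinner (col U i) (A *\<^sub>v col U i)"
      by (simp add: cinner_def)
  qed (simp add: dim_unitary)
  finally show ?thesis .
qed

lemma psd_spectral_mat: "(\<And>i. i < n \<Longrightarrow> 0 \<le> r i) \<Longrightarrow> psd n (spectral_mat n U r)"
  by (auto simp: psd_def spectral_mat_adjoint cinner_spectral_mat dim_spectral_mat carrier_matI
      intro!: sum_nonneg)

end

lemma psdD:
  assumes "psd n A"
  shows "A \<in> carrier_mat n n" "dim_row A = n" "dim_col A = n" "mat_adjoint A = A"
    "v \<in> carrier_vec n \<Longrightarrow> 0 \<le> Re (cinner v (A *\<^sub>v v))"
  using assms by (auto simp: psd_def)

lemma psd_diagonalisation:
  assumes "psd n A"
  obtains U r where "unitary n U" "A = spectral_mat n U r" "\<And>i. i < n \<Longrightarrow> 0 \<le> r i"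
proof -
  note A = psdD[OF assms]
  obtain U r where U: "unitary n U" and r: "A = spectral_mat n U r"
    using hermitian_diagonalisation[OF A(1,4)] unfolding spectral_mat_def by blast
  have "0 \<le> r i" if "i < n" for i
    using A(5)[of "col U i"] cinner_spectral_mat_col[OF U that, of r] that
    by (auto simp: r carrier_vecI dim_unitary[OF U])
  with U r show thesis by (rule that)
qed

lemma mat_eq_by_vec:
  assumes "A \<in> carrier_mat n m" "B \<in> carrier_mat n m" "\<And>v. v \<in> carrier_vec m \<Longrightarrow> A *\<^sub>v v = B *\<^sub>v v"
  shows "A = (B :: complex mat)"
proof (rule eq_matI)
  fix i j assume "i < dim_row B" "j < dim_col B"
  then have ij: "i < n" "j < m" using assms by auto
  have "(A *\<^sub>v unit_vec m j) $ i = (B *\<^sub>v unit_vec m j) $ i" using assms(3) by simp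
  then show "A $$ (i, j) = B $$ (i, j)" using ij assms(1,2) by simp
qed (use assms in auto)

subsection \<open>Square roots and fidelity\<close>

text \<open>On an eigenvector \<open>v\<close> of \<open>C\<close> with eigenvalue \<open>a\<close>,
  equality of the squares reads \<open>(B + a) (B - a) v = 0\<close>. For \<open>a > 0\<close>
  positivity of \<open>B\<close> excludes the eigenvalue \<open>- a\<close>, hence
  \<open>(B - a) v = 0\<close>. Such \<open>v\<close> form a basis, so \<open>B\<close> and
  \<open>C\<close> agree.\<close>

lemma psd_sqrt_unique:
  assumes "psd n B" "psd n C" "B * B = C * C"
  shows "B = C"
proof -
  note B = psdD[OF assms(1)] and C = psdD[OF assms(2)]
  obtain U r where U: "unitary n U" and Cr: "C = spectral_mat n U r" and r: "\<And>i. i < n \<Longrightarrow> 0 \<le> r i"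
    using psd_diagonalisation[OF assms(2)] by blast
  note [simp] = dim_unitary[OF U]
  have "B *\<^sub>v col U i = complex_of_real (r i) \<cdot>\<^sub>v col U i" if i: "i < n" for i
  proof -
    define v where "v = col U i"
    define a where "a = complex_of_real (r i)"
    have v: "v \<in> carrier_vec n" "dim_vec v = n" by (auto simp: v_def carrier_vecI)
    have Cv: "C *\<^sub>v v = a \<cdot>\<^sub>v v" using spectral_mat_eigen[OF U i] by (simp add: Cr v_def a_def)
    have BBv: "B *\<^sub>v (B *\<^sub>v v) = (a * a) \<cdot>\<^sub>v v"
    proof -
      have "B *\<^sub>v (B *\<^sub>v v) = (B * B) *\<^sub>v v" using B v by (simp add: mult_vec_assoc_dim)
      also have "\<dots> = C *\<^sub>v (C *\<^sub>v v)" using C v by (simp add: assms(3) mult_vec_assoc_dim)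
      also have "\<dots> = (a * a) \<cdot>\<^sub>v v" using C v by (simp add: Cv mult_mat_vec[OF C(1)] smult_smult_assoc)
      finally show ?thesis .
    qed
    define w where "w = B *\<^sub>v v - a \<cdot>\<^sub>v v"
    have w: "w \<in> carrier_vec n" "dim_vec w = n" using B v by (auto simp: w_def)
    have "w = 0\<^sub>v n"
    proof (cases "r i = 0")
      case True
      \<comment> \<open>For \<open>a = 0\<close> the sign argument is void; instead the squared norm
        of \<open>B v\<close> is the expectation of \<open>B * B\<close> in \<open>v\<close>, which
        vanishes.\<close>
      have "cinner (B *\<^sub>v v) (B *\<^sub>v v) = cinner v (B *\<^sub>v (B *\<^sub>v v))"
        using B v by (simp add: cinner_mult_mat_vec)
      also have "\<dots> = 0" using True v by (simp add: BBv a_def cinner_smult_right)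
      finally have "B *\<^sub>v v = 0\<^sub>v n" using B by (simp add: cinner_self_eq_0)
      then show ?thesis using True v by (intro eq_vecI) (auto simp: w_def a_def)
    next
      case False
      have "B *\<^sub>v w = (- a) \<cdot>\<^sub>v w"
        using B v unfolding w_def
        by (subst mult_minus_distrib_mat_vec[of _ n n])
          (auto simp: BBv mult_mat_vec[OF B(1)] algebra_simps intro!: eq_vecI simp del: index_mult_mat_vec)
      then have "cinner w (B *\<^sub>v w) = - complex_of_real (r i * vnorm2 w)"
        using w by (simp add: cinner_smult_right cinner_self a_def)
      with B(5)[OF w(1)] have "r i * vnorm2 w \<le> 0" by simp
      with r[OF i] False have "vnorm2 w \<le> 0" by (simp add: mult_le_0_iff)
      then have "vnorm2 w = 0" using vnorm2_nonneg[of w] by linarith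
      then show ?thesis using w by (simp add: vnorm2_eq_0_iff)
    qed
    then have "\<And>j. j < n \<Longrightarrow> (B *\<^sub>v v) $ j = (a \<cdot>\<^sub>v v) $ j"
      using v B unfolding w_def by (metis carrier_vecD diff_eq_diff_eq eq_iff_diff_eq_0 index_minus_vec(1)
        index_smult_vec(2) index_zero_vec(1))
    then show ?thesis using v B unfolding v_def[symmetric] a_def[symmetric] by (intro eq_vecI) auto
  qed
  then have "col (B * U) i = col (C * U) i" if "i < n" for i
    using that B C U spectral_mat_eigen[OF U that, of r]
    by (subst (1 2) col_mult2[of _ n n _ n]) (auto simp: Cr)
  then have "B * U = C * U" using B C by (intro mat_col_eqI) auto
  then have "B * U * mat_adjoint U = C * U * mat_adjoint U" by simp
  then show "B = C" using B C U by (simp add: mult_assoc_dim) (simp add: unitary_def)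
qed

text \<open>Unfolding the definite description needs a unique positive root: existence takes roots
  of the eigenvalues, uniqueness is \<open>psd_sqrt_unique\<close>.\<close>

lemma msqrt_props:
  assumes "psd n A"
  shows "psd n (msqrt A)" "msqrt A * msqrt A = A"
proof -
  obtain U r where U: "unitary n U" and Ar: "A = spectral_mat n U r" and r: "\<And>i. i < n \<Longrightarrow> 0 \<le> r i"
    using psd_diagonalisation[OF assms] by blast
  let ?B = "spectral_mat n U (\<lambda>i. sqrt (r i))"
  have "real_diag n (\<lambda>i. sqrt (r i) * sqrt (r i)) = real_diag n r"
    using r by (intro eq_matI) (auto simp: real_diag_def simp flip: of_real_mult)
  then have B: "psd n ?B \<and> ?B * ?B = A"
    using r U by (simp add: psd_spectral_mat spectral_mat_mult) (simp add: spectral_mat_def Ar)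
  have "\<exists>!B. psd n B \<and> B * B = A"
  proof (rule ex1I[of _ ?B])
    fix B' assume "psd n B' \<and> B' * B' = A"
    then show "B' = ?B" using B psd_sqrt_unique[of n B' ?B] by metis
  qed (rule B)
  from theI'[OF this] have "psd (dim_row A) (msqrt A) \<and> msqrt A * msqrt A = A"
    unfolding msqrt_def psdD(2)[OF assms] .
  then show "psd n (msqrt A)" "msqrt A * msqrt A = A" using psdD(2)[OF assms] by auto
qed

lemma mult_adjoint_psd:
  assumes "A \<in> carrier_mat n m"
  shows "psd m (mat_adjoint A * A)"
  unfolding psd_def
proof (intro conjI ballI)
  fix v :: "complex vec" assume v: "v \<in> carrier_vec m"
  have "cinner v ((mat_adjoint A * A) *\<^sub>v v) = complex_of_real (vnorm2 (A *\<^sub>v v))"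
    using assms v by (auto simp: mult_vec_assoc_dim cinner_mult_mat_vec simp flip: cinner_self)
  then show "0 \<le> Re (cinner v ((mat_adjoint A * A) *\<^sub>v v))" "Im (cinner v ((mat_adjoint A * A) *\<^sub>v v)) = 0"
    by auto
qed (use assms in \<open>auto simp: mat_adjoint_mult\<close>)

lemma mult_mat_eq_0_by_vec:
  assumes "A \<in> carrier_mat n m" "\<And>v. v \<in> carrier_vec m \<Longrightarrow> vnorm2 (A *\<^sub>v v) \<le> 0"
  shows "A = 0\<^sub>m n m"
proof (rule mat_eq_by_vec[OF assms(1)])
  fix v :: "complex vec" assume v: "v \<in> carrier_vec m"
  have "vnorm2 (A *\<^sub>v v) = 0" using assms(2)[OF v] vnorm2_nonneg by (metis antisym)
  then show "A *\<^sub>v v = 0\<^sub>m n m *\<^sub>v v" using v assms(1) by (auto simp: vnorm2_eq_0_iff)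
qed simp

text \<open>Douglas factorisation: the hypothesis yields a contraction \<open>W\<close> with
  \<open>W \<surd>\<sigma> = \<surd>\<rho> B\<^sup>\<dagger>\<close>; pairing it with \<open>\<surd>\<rho> \<surd>\<sigma>\<close>, whose trace norm is the fidelity, gives the bound.\<close>

lemma fidelity_ge:
  assumes "psd n \<sigma>" "psd n \<rho>" "B \<in> carrier_mat n n"
    and dom: "\<And>v. v \<in> carrier_vec n \<Longrightarrow>
      Re (cinner (mat_adjoint B *\<^sub>v v) (\<rho> *\<^sub>v (mat_adjoint B *\<^sub>v v))) \<le> Re (cinner v (\<sigma> *\<^sub>v v))"
  shows "Re (ctrace (B * \<rho>)) \<le> fidelity \<sigma> \<rho>"
proof -
  define s where "s = msqrt \<sigma>"
  define r where "r = msqrt \<rho>"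
  note s2 = msqrt_props(2)[OF assms(1), folded s_def]
  note r2 = msqrt_props(2)[OF assms(2), folded r_def]
  note s = psdD[OF msqrt_props(1)[OF assms(1), folded s_def]]
  note r = psdD[OF msqrt_props(1)[OF assms(2), folded r_def]]
  have [simp]: "dim_row B = n" "dim_col B = n" using assms(3) by auto
  note [simp] = s(2-4) r(2-4)
  obtain U t where U: "unitary n U" and st: "s = spectral_mat n U t"
    using psd_diagonalisation[OF msqrt_props(1)[OF assms(1), folded s_def]] by blast
  note [simp] = dim_unitary[OF U] dim_spectral_mat[OF U]
  \<comment> \<open>In HOL \<open>inverse 0 = 0\<close>, so \<open>p\<close> is the Moore-Penrose
    inverse of \<open>s\<close> and \<open>P\<close> the projector onto the range of
    \<open>s\<close>; this covers singular \<open>\<sigma>\<close>.\<close>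
  define p where "p = spectral_mat n U (\<lambda>i. inverse (t i))"
  define P where "P = spectral_mat n U (\<lambda>i. t i * inverse (t i))"
  have [simp]: "dim_row p = n" "dim_col p = n" "dim_row P = n" "dim_col P = n" by (auto simp: p_def P_def)
  have sp: "s * p = P" and ps: "p * s = P"
    by (simp_all add: st p_def P_def spectral_mat_mult[OF U] mult.commute)
  define M where "M = r * mat_adjoint B"
  have [simp]: "dim_row M = n" "dim_col M = n" by (auto simp: M_def)
  have norm_s: "Re (cinner v (\<sigma> *\<^sub>v v)) = vnorm2 (s *\<^sub>v v)" if "v \<in> carrier_vec n" for v
    using that by (subst vnorm2_mult_mat_vec) (auto simp: s2)
  have M_le: "vnorm2 (M *\<^sub>v v) \<le> vnorm2 (s *\<^sub>v v)" if v: "v \<in> carrier_vec n" for v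
  proof -
    have "vnorm2 (M *\<^sub>v v) = vnorm2 (r *\<^sub>v (mat_adjoint B *\<^sub>v v))"
      using v by (simp add: M_def mult_vec_assoc_dim)
    also have "\<dots> = Re (cinner (mat_adjoint B *\<^sub>v v) (\<rho> *\<^sub>v (mat_adjoint B *\<^sub>v v)))"
      by (subst vnorm2_mult_mat_vec) (auto simp: r2)
    finally show ?thesis using dom[OF v] norm_s[OF v] by simp
  qed
  \<comment> \<open>\<open>M_le\<close> forces \<open>M\<close> to vanish wherever \<open>s\<close>
    does, in particular on the range of \<open>1\<^sub>m n - P\<close>.\<close>
  have MP: "M * P = M"
  proof -
    have sQ: "s * (1\<^sub>m n - P) = 0\<^sub>m n n"
    proof -
      have "(\<lambda>i. t i * (t i * inverse (t i))) = t" by (rule ext) (metis mult_zero_left mult.right_neutral right_inverse)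
      then have "s * P = s" by (simp add: st P_def spectral_mat_mult[OF U])
      then show ?thesis using s(1) by (subst mult_minus_distrib_mat[of _ n n _ n]) (auto simp: carrier_matI)
    qed
    have "M * (1\<^sub>m n - P) = 0\<^sub>m n n"
    proof (rule mult_mat_eq_0_by_vec)
      fix v :: "complex vec" assume v: "v \<in> carrier_vec n"
      have Qv: "(1\<^sub>m n - P) *\<^sub>v v \<in> carrier_vec n" by (rule carrier_vecI) simp
      have "vnorm2 ((M * (1\<^sub>m n - P)) *\<^sub>v v) \<le> vnorm2 ((s * (1\<^sub>m n - P)) *\<^sub>v v)"
        using v M_le[OF Qv] by (subst (1 2) mult_vec_assoc_dim) auto
      also have "\<dots> = 0" using v unfolding sQ by (simp add: vnorm2_def)
      finally show "vnorm2 ((M * (1\<^sub>m n - P)) *\<^sub>v v) \<le> 0" .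
    qed (auto simp: carrier_matI)
    then have "M - M * P = 0\<^sub>m n n"
      by (subst (asm) mult_minus_distrib_mat[of _ n n _ n]) (auto simp: carrier_matI)
    then have diff: "(M - M * P) $$ (i, j) = 0" if "i < n" "j < n" for i j using that by simp
    show ?thesis
    proof (rule eq_matI)
      fix i j assume "i < dim_row M" "j < dim_col M"
      then have "i < n" "j < n" by auto
      then show "(M * P) $$ (i, j) = M $$ (i, j)" using diff[of i j] by (simp del: index_mult_mat(1))
    qed auto
  qed
  \<comment> \<open>The Douglas quotient of \<open>M\<close> by \<open>s\<close>. \<open>MP\<close>
    makes it solve \<open>W * s = M\<close>; \<open>M_le\<close> makes it a contraction, because
    \<open>s * p\<close> is the projector \<open>P\<close>.\<close>
  define W where "W = M * p"
  have [simp]: "dim_row W = n" "dim_col W = n" by (auto simp: W_def)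
  have Ws: "W * s = M" by (simp add: W_def mult_assoc_dim ps MP)
  have W_le: "vnorm2 (W *\<^sub>v v) \<le> vnorm2 v" if v: "v \<in> carrier_vec n" for v
  proof -
    have "vnorm2 (W *\<^sub>v v) = vnorm2 (M *\<^sub>v (p *\<^sub>v v))"
      using v by (simp add: W_def mult_vec_assoc_dim)
    also have "\<dots> \<le> vnorm2 (s *\<^sub>v (p *\<^sub>v v))" by (rule M_le) (simp add: carrier_vecI)
    also have "\<dots> = vnorm2 (P *\<^sub>v v)" using v by (simp add: sp flip: mult_vec_assoc_dim)
    also have "\<dots> = Re (cinner v ((mat_adjoint P * P) *\<^sub>v v))"
      using v by (intro vnorm2_mult_mat_vec) auto
    also have "\<dots> = (\<Sum>i<n. (t i * inverse (t i))\<^sup>2 * (cmod (cinner (col U i) v))\<^sup>2)"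
      unfolding P_def spectral_mat_adjoint[OF U] spectral_mat_mult[OF U]
      by (simp only: cinner_spectral_mat[OF U v] Re_complex_of_real power2_eq_square)
    also have "\<dots> \<le> (\<Sum>i<n. 1 * (cmod (cinner (col U i) v))\<^sup>2)"
    proof (intro sum_mono mult_right_mono)
      fix i show "(t i * inverse (t i))\<^sup>2 \<le> 1" by (cases "t i = 0") simp_all
    qed simp
    finally show ?thesis using parseval[OF U v] by simp
  qed
  \<comment> \<open>The modulus of \<open>X\<close> is \<open>msqrt (s * \<rho> * s)\<close>, so the
    fidelity is the sum of the singular values of \<open>X\<close>.\<close>
  define X where "X = r * s"
  have [simp]: "dim_row X = n" "dim_col X = n" by (auto simp: X_def)
  have XX: "mat_adjoint X * X = s * \<rho> * s"
  proof -
    have "mat_adjoint X * X = s * (r * r) * s" by (simp add: X_def mat_adjoint_mult mult_assoc_dim)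
    then show ?thesis by (simp add: r2)
  qed
  define C where "C = msqrt (s * \<rho> * s)"
  have "psd n (s * \<rho> * s)" unfolding XX[symmetric] by (rule mult_adjoint_psd[of _ n]) (auto intro: carrier_matI)
  note C = msqrt_props[OF this, folded C_def]
  obtain F c where F: "unitary n F" and Cc: "C = spectral_mat n F c" and c: "\<And>i. i < n \<Longrightarrow> 0 \<le> c i"
    using psd_diagonalisation[OF C(1)] by blast
  note [simp] = dim_unitary[OF F]
  \<comment> \<open>Passing to the adjoint leaves the real part alone and brings
    \<open>M = r * mat_adjoint B\<close> into the trace, where \<open>W * s\<close> can replace
    it.\<close>
  have "ctrace (mat_adjoint (B * \<rho>)) = ctrace (\<rho> * mat_adjoint B)"
    using psdD[OF assms(2)] by (simp add: mat_adjoint_mult)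
  also have "\<dots> = ctrace (r * (r * mat_adjoint B))" by (simp add: mult_assoc_dim flip: r2)
  also have "\<dots> = ctrace (M * r)" by (simp add: ctrace_cyclic[of r] M_def)
  also have "\<dots> = ctrace (W * mat_adjoint X)"
    by (simp add: X_def mat_adjoint_mult mult_assoc_dim flip: Ws)
  also have "\<dots> = ctrace (mat_adjoint X * W)" by (simp add: ctrace_cyclic)
  also have "\<dots> = (\<Sum>i<n. cinner (col F i) ((mat_adjoint X * W) *\<^sub>v col F i))"
    by (rule ctrace_eq_sum_cinner[OF F]) (simp add: carrier_matI)
  also have "\<dots> = (\<Sum>i<n. cinner (X *\<^sub>v col F i) (W *\<^sub>v col F i))"
    by (simp add: mult_vec_assoc_dim cinner_mult_mat_vec)
  finally have "cnj (ctrace (B * \<rho>)) = (\<Sum>i<n. cinner (X *\<^sub>v col F i) (W *\<^sub>v col F i))"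
    using psdD[OF assms(2)] by (simp add: ctrace_adjoint)
  from arg_cong[OF this, of Re]
  have "Re (ctrace (B * \<rho>)) = (\<Sum>i<n. Re (cinner (X *\<^sub>v col F i) (W *\<^sub>v col F i)))" by simp
  \<comment> \<open>An eigenvector of \<open>C\<close> is a right singular vector of
    \<open>X\<close>: its image under \<open>X\<close> has norm exactly \<open>c i\<close>, and its
    image under \<open>W\<close> has norm at most 1.\<close>
  also have "\<dots> \<le> (\<Sum>i<n. c i)"
  proof (rule sum_mono)
    fix i assume "i \<in> {..<n}"
    then have i: "i < n" by simp
    have fi: "col F i \<in> carrier_vec n" by (simp add: carrier_vecI)
    have "vnorm2 (col F i) = 1" using cinner_col_unitary[OF F i i] by (simp add: cinner_self)
    with W_le[OF fi] have W1: "sqrt (vnorm2 (W *\<^sub>v col F i)) \<le> 1" by simp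
    have "vnorm2 (X *\<^sub>v col F i) = Re (cinner (col F i) ((C * C) *\<^sub>v col F i))"
      by (subst vnorm2_mult_mat_vec) (auto simp: XX C(2))
    also have "\<dots> = (c i)\<^sup>2"
      by (simp add: Cc spectral_mat_mult[OF F] cinner_spectral_mat_col[OF F i] power2_eq_square)
    finally have X1: "sqrt (vnorm2 (X *\<^sub>v col F i)) = c i" using c[OF i] by simp
    have "Re (cinner (X *\<^sub>v col F i) (W *\<^sub>v col F i)) \<le> cmod (cinner (X *\<^sub>v col F i) (W *\<^sub>v col F i))"
      by (rule complex_Re_le_cmod)
    also have "\<dots> \<le> sqrt (vnorm2 (X *\<^sub>v col F i)) * sqrt (vnorm2 (W *\<^sub>v col F i))"
      by (rule cinner_Cauchy_Schwarz) simp
    also have "\<dots> \<le> c i" unfolding X1 using W1 c[OF i] by (rule mult_left_le)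
    finally show "Re (cinner (X *\<^sub>v col F i) (W *\<^sub>v col F i)) \<le> c i" .
  qed
  also have "\<dots> = Re (ctrace C)"
    using ctrace_eq_sum_cinner[OF F psdD(1)[OF C(1)]] by (simp add: Cc cinner_spectral_mat_col[OF F])
  also have "\<dots> = fidelity \<sigma> \<rho>" by (simp add: fidelity_def C_def s_def)
  finally show ?thesis .
qed

subsection \<open>Kronecker products and the circuit\<close>

lemma dim_kron [simp]:
  "dim_row (kron A B) = dim_row A * dim_row B" "dim_col (kron A B) = dim_col A * dim_col B"
  by (auto simp: kron_def)

lemma index_kron [simp]:
  "i < dim_row A * dim_row B \<Longrightarrow> j < dim_col A * dim_col B \<Longrightarrow> kron A B $$ (i, j) =
    A $$ (i div dim_row B, j div dim_col B) * B $$ (i mod dim_row B, j mod dim_col B)"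
  by (simp add: kron_def)

text \<open>Blocks of length \<open>b\<close> are the ranges on which \<open>div b\<close> is
  constant; grouping by them separates the two tensor factors of a composite index.\<close>

lemma sum_div_mod:
  fixes h :: "nat \<Rightarrow> nat \<Rightarrow> 'a :: comm_monoid_add"
  shows "(\<Sum>k<a * b. h (k div b) (k mod b)) = (\<Sum>i<a. \<Sum>j<b. h i j)"
proof -
  have "(\<Sum>k<a * b. h (k div b) (k mod b)) = (\<Sum>i<a. \<Sum>k = i * b..<i * b + b. h (k div b) (k mod b))"
    by (rule sum.nat_group[symmetric])
  also have "\<dots> = (\<Sum>i<a. \<Sum>j<b. h i j)"
  proof (rule sum.cong[OF refl])
    fix i
    have "(\<Sum>k = i * b..<i * b + b. h (k div b) (k mod b)) =
        (\<Sum>j = 0..<b. h ((j + i * b) div b) ((j + i * b) mod b))"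
      using sum.shift_bounds_nat_ivl[of "\<lambda>k. h (k div b) (k mod b)" 0 "i * b" b] by (simp add: add.commute)
    then show "(\<Sum>k = i * b..<i * b + b. h (k div b) (k mod b)) = (\<Sum>j<b. h i j)"
      by (simp add: atLeast0LessThan)
  qed
  finally show ?thesis .
qed

lemma mod_less_of_less_mult: "i < a * (b::nat) \<Longrightarrow> i mod b < b"
  by (cases "b = 0") auto

lemma kron_mult:
  assumes "dim_col A = dim_row C" "dim_col B = dim_row D"
  shows "kron A B * kron C D = kron (A * C) (B * D)"
proof (rule eq_matI)
  fix i j assume "i < dim_row (kron (A * C) (B * D))" "j < dim_col (kron (A * C) (B * D))"
  then have ij: "i < dim_row A * dim_row B" "j < dim_col C * dim_col D" by auto
  note lt = mod_less_of_less_mult[OF ij(1)] mod_less_of_less_mult[OF ij(2)]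
    less_mult_imp_div_less[OF ij(1)] less_mult_imp_div_less[OF ij(2)]
  have "(kron A B * kron C D) $$ (i, j) = (\<Sum>k<dim_row C * dim_row D.
      (A $$ (i div dim_row B, k div dim_row D) * C $$ (k div dim_row D, j div dim_col D)) *
      (B $$ (i mod dim_row B, k mod dim_row D) * D $$ (k mod dim_row D, j mod dim_col D)))"
    using ij assms by (simp add: mult_mat_index_sum mult_ac del: index_mult_mat(1))
  also have "\<dots> = (\<Sum>k<dim_row C. \<Sum>l<dim_row D.
      (A $$ (i div dim_row B, k) * C $$ (k, j div dim_col D)) *
      (B $$ (i mod dim_row B, l) * D $$ (l, j mod dim_col D)))"
    by (rule sum_div_mod)
  also have "\<dots> = kron (A * C) (B * D) $$ (i, j)"
    using ij lt assms by (simp add: mult_mat_index_sum sum_product del: index_mult_mat(1))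
  finally show "(kron A B * kron C D) $$ (i, j) = kron (A * C) (B * D) $$ (i, j)" .
qed (use assms in auto)

lemma kron_assoc: "kron (kron A B) C = kron A (kron B C)"
proof (rule eq_matI)
  fix i j assume "i < dim_row (kron A (kron B C))" "j < dim_col (kron A (kron B C))"
  then have ij: "i < dim_row A * dim_row B * dim_row C" "j < dim_col A * dim_col B * dim_col C"
    by (auto simp: mult.assoc)
  have *: "i mod (b * c) div c = i div c mod b" for i b c :: nat
    by (cases "c = 0") (simp_all add: mod_mult2_eq[of i c b] mult.commute[of b c])
  have **: "i mod (b * c) mod c = i mod c" "i div (b * c) = i div c div b" for i b c :: nat
    by (simp_all add: mod_mod_cancel div_mult2_eq mult.commute[of b c])
  have ij': "i < dim_row A * (dim_row B * dim_row C)" "j < dim_col A * (dim_col B * dim_col C)"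
    using ij by (simp_all add: mult.assoc)
  show "kron (kron A B) C $$ (i, j) = kron A (kron B C) $$ (i, j)"
    using ij ij' less_mult_imp_div_less[OF ij(1)] less_mult_imp_div_less[OF ij(2)]
      mod_less_of_less_mult[OF ij'(1)] mod_less_of_less_mult[OF ij'(2)]
    by (simp add: * **)
qed (auto simp: mult.assoc)

lemma kron_adjoint: "mat_adjoint (kron A B) = kron (mat_adjoint A) (mat_adjoint B)"
  by (rule eq_matI) (auto simp: less_mult_imp_div_less mod_less_of_less_mult)

lemma kron_add_left:
  "dim_row A = dim_row B \<Longrightarrow> dim_col A = dim_col B \<Longrightarrow> kron (A + B) C = kron A C + kron B C"
  by (rule eq_matI) (auto simp: less_mult_imp_div_less mod_less_of_less_mult distrib_right)

lemma kron_add_right: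
  "dim_row A = dim_row B \<Longrightarrow> dim_col A = dim_col B \<Longrightarrow> kron C (A + B) = kron C A + kron C B"
  by (rule eq_matI) (auto simp: less_mult_imp_div_less mod_less_of_less_mult distrib_left)

lemma kron_smult_left: "kron (c \<cdot>\<^sub>m A) B = c \<cdot>\<^sub>m kron A B"
  by (rule eq_matI) (auto simp: less_mult_imp_div_less)

lemma kron_one: "kron (1\<^sub>m n) (1\<^sub>m m) = 1\<^sub>m (n * m)"
proof (rule eq_matI)
  fix i j assume "i < dim_row (1\<^sub>m (n * m) :: complex mat)" "j < dim_col (1\<^sub>m (n * m) :: complex mat)"
  then have ij: "i < n * m" "j < n * m" by auto
  have "i div m = j div m \<and> i mod m = j mod m \<longleftrightarrow> i = j"
    by (metis div_mult_mod_eq)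
  then show "kron (1\<^sub>m n) (1\<^sub>m m) $$ (i, j) = 1\<^sub>m (n * m) $$ (i, j)"
    using ij by (auto simp: less_mult_imp_div_less mod_less_of_less_mult)
qed auto

lemma kron_zero_left: "kron (0\<^sub>m n m) A = 0\<^sub>m (n * dim_row A) (m * dim_col A)"
  by (rule eq_matI) (auto simp: less_mult_imp_div_less)

lemma kron_zero_right: "kron A (0\<^sub>m n m) = 0\<^sub>m (dim_row A * n) (dim_col A * m)"
  by (rule eq_matI) (auto simp: mod_less_of_less_mult)

lemma kron_one_1_left [simp]: "kron (1\<^sub>m (Suc 0)) A = A"
  by (rule eq_matI) auto

lemma dim_kpow [simp]: "dim_row (kpow A n) = dim_row A ^ n" "dim_col (kpow A n) = dim_col A ^ n"
  by (induction n) auto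

lemma kpow_mult: "dim_col A = dim_row B \<Longrightarrow> kpow (A * B) n = kpow A n * kpow B n"
  by (induction n) (auto simp: kron_mult)

lemma kpow_adjoint: "mat_adjoint (kpow A n) = kpow (mat_adjoint A) n"
  by (induction n) (auto simp: kron_adjoint)

lemma kpow_one_1 [simp]: "kpow (1\<^sub>m (Suc 0)) n = 1\<^sub>m (Suc 0)"
  by (induction n) auto

section \<open>Ordered products of gates\<close>

definition mat_chain :: "nat \<Rightarrow> (nat \<Rightarrow> complex mat) \<Rightarrow> nat list \<Rightarrow> complex mat" where
  "mat_chain N G js = foldl (\<lambda>M j. G j * M) (1\<^sub>m N) js"

lemma mat_chain_Nil [simp]: "mat_chain N G [] = 1\<^sub>m N"
  by (simp add: mat_chain_def)

lemma mat_chain_snoc: "mat_chain N G (js @ [j]) = G j * mat_chain N G js"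
  by (simp add: mat_chain_def)

lemma mat_chain_carrier:
  "(\<And>j. j \<in> set js \<Longrightarrow> G j \<in> carrier_mat N N) \<Longrightarrow> mat_chain N G js \<in> carrier_mat N N"
  by (induction js rule: rev_induct) (simp_all add: mat_chain_snoc mult_carrier_mat[of _ N N _ N])

text \<open>\<open>foldl\<close> exposes the gate applied last, whereas the recursion on the number
  of ancillas removes the one applied first.\<close>

lemma mat_chain_Cons:
  assumes "\<And>j'. j' \<in> set (j # js) \<Longrightarrow> G j' \<in> carrier_mat N N"
  shows "mat_chain N G (j # js) = mat_chain N G js * G j"
  using assms
proof (induction js rule: rev_induct)
  case Nil
  then show ?case by (auto simp: mat_chain_def)
next
  case (snoc i js)
  have "mat_chain N G ((j # js) @ [i]) = G i * (mat_chain N G js * G j)"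
    unfolding mat_chain_snoc by (subst snoc.IH) (use snoc.prems in auto)
  also have "\<dots> = mat_chain N G (js @ [i]) * G j"
    using snoc.prems mat_chain_carrier[of js G N] unfolding mat_chain_snoc
    by (subst mult_assoc_dim) auto
  finally show ?case by simp
qed

lemma mat_chain_map: "mat_chain N G (map f js) = mat_chain N (G \<circ> f) js"
  by (simp add: mat_chain_def foldl_map)

lemma mat_chain_cong: "(\<And>j. j \<in> set js \<Longrightarrow> G j = H j) \<Longrightarrow> mat_chain N G js = mat_chain N H js"
  by (induction js rule: rev_induct) (auto simp: mat_chain_snoc)

lemma mat_chain_kron:
  assumes "\<And>j. j \<in> set js \<Longrightarrow> G j \<in> carrier_mat N N"
  shows "mat_chain (m * N) (\<lambda>j. kron (1\<^sub>m m) (G j)) js = kron (1\<^sub>m m) (mat_chain N G js)"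
  using assms
proof (induction js rule: rev_induct)
  case (snoc j js)
  have "mat_chain (m * N) (\<lambda>j. kron (1\<^sub>m m) (G j)) js = kron (1\<^sub>m m) (mat_chain N G js)"
    by (rule snoc.IH) (use snoc.prems in auto)
  moreover have "mat_chain N G js \<in> carrier_mat N N" "G j \<in> carrier_mat N N"
    using snoc.prems by (auto intro: mat_chain_carrier)
  ultimately show ?case by (auto simp: mat_chain_snoc kron_mult)
qed (simp add: kron_one)

text \<open>Taking adjoints reverses a product, and the factors are self-adjoint. For the unitary
  circuit it says that step (iii) undoes step (i).\<close>

lemma mat_chain_rev:
  assumes "\<And>j. j \<in> set js \<Longrightarrow> G j \<in> carrier_mat N N \<and> mat_adjoint (G j) = G j"
  shows "mat_chain N G (rev js) = mat_adjoint (mat_chain N G js)"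
  using assms
proof (induction js)
  case (Cons j js)
  have "mat_chain N G (rev (j # js)) = mat_adjoint (G j) * mat_adjoint (mat_chain N G js)"
    using Cons by (simp add: mat_chain_snoc)
  also have "\<dots> = mat_adjoint (mat_chain N G js * G j)"
    using Cons.prems mat_chain_carrier[of js G N] by (subst mat_adjoint_mult) auto
  finally show ?case using Cons.prems by (subst mat_chain_Cons) auto
qed simp

lemma mat_chain_unitary:
  "(\<And>j. j \<in> set js \<Longrightarrow> unitary N (G j)) \<Longrightarrow> unitary N (mat_chain N G js)"
  by (induction js rule: rev_induct) (auto simp: mat_chain_snoc intro: unitary_mult unitaryI)

section \<open>Rank-one operators and reflections\<close>

lemma dim_outer [simp]: "dim_row (outer v w) = dim_vec v" "dim_col (outer v w) = dim_vec w"
  by (auto simp: outer_def)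

lemma outer_adjoint [simp]: "mat_adjoint (outer v w) = outer w v"
  by (rule eq_matI) (auto simp: outer_def)

lemma outer_mult_vec:
  "dim_vec w = dim_vec u \<Longrightarrow> outer v w *\<^sub>v u = cinner w u \<cdot>\<^sub>v v"
  by (rule eq_vecI)
    (auto simp: outer_def mult_mat_vec_index_sum cinner_sum sum_distrib_left mult_ac
      simp del: index_mult_mat_vec)

lemma outer_mult_outer:
  "dim_vec w = dim_vec u \<Longrightarrow> outer v w * outer u x = cinner w u \<cdot>\<^sub>m outer v x"
  by (rule eq_matI)
    (auto simp: outer_def mult_mat_index_sum cinner_sum sum_distrib_left sum_distrib_right mult_ac
      simp del: index_mult_mat(1))

lemma dim_refl [simp]: "dim_row (refl d v) = dim_vec v" "dim_col (refl d v) = dim_vec v"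
  by (auto simp: refl_def)

lemma refl_adjoint: "v \<in> carrier_vec d \<Longrightarrow> mat_adjoint (refl d v) = refl d v"
  by (auto simp: refl_def mat_adjoint_minus mat_adjoint_smult)

lemma refl_square:
  assumes "unit_vec_c d v"
  shows "refl d v * refl d v = 1\<^sub>m d"
proof -
  have v: "v \<in> carrier_vec d" "dim_vec v = d" and 1: "cinner v v = 1"
    using assms by (auto simp: unit_vec_c_def)
  let ?P = "outer v v"
  have P: "?P \<in> carrier_mat d d" "2 \<cdot>\<^sub>m ?P \<in> carrier_mat d d" "1\<^sub>m d - 2 \<cdot>\<^sub>m ?P \<in> carrier_mat d d"
    using v by (auto intro: carrier_matI)
  \<comment> \<open>Normalisation of \<open>v\<close> enters here: it makes \<open>?P\<close>
    idempotent, so that the multiples of \<open>?P\<close> cancel in the expanded square.\<close>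
  have PP: "?P * ?P = ?P" using v 1 by (auto simp: outer_mult_outer intro!: eq_matI)
  have "refl d v * refl d v = (1\<^sub>m d - 2 \<cdot>\<^sub>m ?P) - (2 \<cdot>\<^sub>m ?P - (2 \<cdot>\<^sub>m ?P) * (2 \<cdot>\<^sub>m ?P))"
    unfolding refl_def using P
    by (subst minus_mult_distrib_mat[of _ d d _ _ d]) (auto simp: mult_minus_distrib_mat[of _ d d _ d])
  also have "(2 \<cdot>\<^sub>m ?P) * (2 \<cdot>\<^sub>m ?P) = 4 \<cdot>\<^sub>m ?P"
    using P PP by (subst mult_smult_assoc_mat[of _ d d _ d]) (auto simp: mult_smult_distrib[of _ d d _ d] intro!: eq_matI)
  finally show ?thesis using v by (auto intro!: eq_matI)
qed

section \<open>Operators on one ancilla and the controlled reflections\<close>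

lemma dim_qop [simp]:
  assumes "j < T"
  shows "dim_row (qop T j A) = 2 ^ (T - 1) * dim_row A" "dim_col (qop T j A) = 2 ^ (T - 1) * dim_col A"
proof -
  \<comment> \<open>Subtraction is truncated: \<open>j < T\<close> is what makes the
    \<open>j\<close> qubits before and the \<open>T - j - 1\<close> after add up to
    \<open>T - 1\<close>.\<close>
  have "(2::nat) ^ (T - 1) = 2 ^ j * 2 ^ (T - j - 1)" using assms by (simp flip: power_add)
  then show "dim_row (qop T j A) = 2 ^ (T - 1) * dim_row A" "dim_col (qop T j A) = 2 ^ (T - 1) * dim_col A"
    by (simp_all add: qop_def)
qed

lemma qop_mult: "dim_col A = dim_row B \<Longrightarrow> qop T j A * qop T j B = qop T j (A * B)"
  by (simp add: qop_def kron_mult)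

lemma qop_adjoint: "mat_adjoint (qop T j A) = qop T j (mat_adjoint A)"
  by (simp add: qop_def kron_adjoint)

lemma qop_add: "dim_row A = dim_row B \<Longrightarrow> dim_col A = dim_col B \<Longrightarrow> qop T j (A + B) = qop T j A + qop T j B"
  by (simp add: qop_def kron_add_right kron_add_left)

lemma qop_one: "j < T \<Longrightarrow> qop T j (1\<^sub>m 2) = 1\<^sub>m (2 ^ T)"
proof -
  assume "j < T"
  then have "(2::nat) ^ j * 2 * 2 ^ (T - Suc j) = 2 ^ T"
    by (metis Suc_leI power_Suc2 power_add le_add_diff_inverse)
  then show ?thesis by (simp add: qop_def kron_one)
qed

lemma qop_zero: "j < T \<Longrightarrow> qop T j (0\<^sub>m 2 2) = 0\<^sub>m (2 ^ T) (2 ^ T)"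
proof -
  assume "j < T"
  then have "(2::nat) ^ j * 2 * 2 ^ (T - Suc j) = 2 ^ T"
    by (metis Suc_leI power_Suc2 power_add le_add_diff_inverse)
  then show ?thesis by (simp add: qop_def kron_zero_left kron_zero_right)
qed

lemma qop_Suc: "qop (Suc T) (Suc j) A = kron (1\<^sub>m 2) (qop T j A)"
  by (simp add: qop_def kron_assoc flip: kron_one)

lemma qop_0: "qop (Suc T) 0 A = kron A (1\<^sub>m (2 ^ T))"
  by (simp add: qop_def)

lemma dim_kets [simp]: "dim_vec ket0 = 2" "dim_vec ket1 = 2" "dim_vec ket_minus = 2"
  by (auto simp: ket0_def ket1_def ket_minus_def)

lemma ket_resolution: "outer ket0 ket0 + outer ket1 ket1 = 1\<^sub>m 2"
  by (rule eq_matI) (auto simp: outer_def ket0_def ket1_def)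

lemma ket_orthonormal:
  "cinner ket0 ket0 = 1" "cinner ket1 ket1 = 1" "cinner ket0 ket1 = 0" "cinner ket1 ket0 = 0"
  by (simp_all add: cinner_sum) (simp_all add: ket0_def ket1_def numeral_2_eq_2)

lemma one_smult_mat: "(1 :: complex) \<cdot>\<^sub>m A = A"
  by (rule eq_matI) auto

lemma zero_smult_mat: "(0 :: complex) \<cdot>\<^sub>m A = 0\<^sub>m (dim_row A) (dim_col A)"
  by (rule eq_matI) auto

text \<open>The two control projectors are orthogonal and sum to the identity, so the cross terms of
  the square vanish and the rest is the identity because \<open>refl\<close> is an involution. A
  self-adjoint involution is unitary.\<close>

lemma Rctl_props:
  assumes j: "j < T" and v: "unit_vec_c d (\<phi> k)"
  shows Rctl_carrier: "Rctl T d \<phi> j k \<in> carrier_mat (2 ^ T * d) (2 ^ T * d)"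
    and Rctl_adjoint: "mat_adjoint (Rctl T d \<phi> j k) = Rctl T d \<phi> j k"
    and Rctl_unitary: "unitary (2 ^ T * d) (Rctl T d \<phi> j k)"
proof -
  have [simp]: "dim_vec (\<phi> k) = d" and vc: "\<phi> k \<in> carrier_vec d" using v by (auto simp: unit_vec_c_def)
  have T2: "2 ^ (T - Suc 0) * 2 = (2::nat) ^ T" using j by (metis One_nat_def Suc_pred less_nat_zero_code
        not_gr_zero power_Suc2)
  show carr: "Rctl T d \<phi> j k \<in> carrier_mat (2 ^ T * d) (2 ^ T * d)"
    using j by (auto simp: Rctl_def T2)
  show adj: "mat_adjoint (Rctl T d \<phi> j k) = Rctl T d \<phi> j k"
    using j by (simp add: Rctl_def mat_adjoint_add kron_adjoint qop_adjoint refl_adjoint[OF vc])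
  define a where "a = qop T j (outer ket0 ket0)"
  define b where "b = qop T j (outer ket1 ket1)"
  define r where "r = refl d (\<phi> k)"
  have ab[simp]: "dim_row a = 2 ^ T" "dim_col a = 2 ^ T" "dim_row b = 2 ^ T" "dim_col b = 2 ^ T"
      "dim_row r = d" "dim_col r = d"
    using j by (auto simp: a_def b_def r_def T2)
  have prods: "a * a = a" "b * b = b" "a * b = 0\<^sub>m (2 ^ T) (2 ^ T)" "b * a = 0\<^sub>m (2 ^ T) (2 ^ T)"
    by (auto simp: a_def b_def qop_mult outer_mult_outer ket_orthonormal one_smult_mat zero_smult_mat
        qop_zero j)
  let ?N = "2 ^ T * d"
  have c: "kron a (1\<^sub>m d) \<in> carrier_mat ?N ?N" "kron b r \<in> carrier_mat ?N ?N" by (auto intro: carrier_matI)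
  have "Rctl T d \<phi> j k * Rctl T d \<phi> j k = (kron a (1\<^sub>m d) + kron b r) * (kron a (1\<^sub>m d) + kron b r)"
    by (simp add: Rctl_def a_def b_def r_def)
  also have "\<dots> = kron a (1\<^sub>m d) * kron a (1\<^sub>m d) + kron b r * kron a (1\<^sub>m d)
      + (kron a (1\<^sub>m d) * kron b r + kron b r * kron b r)"
    using c by (simp add: add_mult_distrib_mat[of _ ?N ?N _ _ ?N] mult_add_distrib_mat[of _ ?N ?N _ ?N])
  also have "\<dots> = kron a (1\<^sub>m d) + kron b (r * r)"
    by (simp add: kron_mult prods kron_zero_left) (auto intro!: eq_matI)
  also have "r * r = 1\<^sub>m d" unfolding r_def by (rule refl_square[OF v])
  also have "kron a (1\<^sub>m d) + kron b (1\<^sub>m d) = kron (a + b) (1\<^sub>m d)" by (simp add: kron_add_left)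
  also have "a + b = 1\<^sub>m (2 ^ T)"
    using qop_add[of "outer ket0 ket0" "outer ket1 ket1" T j] j by (simp add: a_def b_def ket_resolution qop_one)
  finally show "unitary ?N (Rctl T d \<phi> j k)" using carr by (intro unitaryI) (simp_all add: adj kron_one)
qed

lemma Rctl_Suc:
  assumes "j < T" "dim_vec (\<phi> k) = d"
  shows "Rctl (Suc T) d \<phi> (Suc j) k = kron (1\<^sub>m 2) (Rctl T d \<phi> j k)"
  using assms by (simp add: Rctl_def qop_Suc kron_assoc kron_add_right)

lemma Ufwd_eq_mat_chain: "Ufwd T d \<phi> ks = mat_chain (2 ^ T * d) (\<lambda>j. Rctl T d \<phi> j (ks ! j)) [0..<T]"
  by (simp add: Ufwd_def mat_chain_def)

lemma Ubwd_eq_mat_chain: "Ubwd T d \<phi> ks = mat_chain (2 ^ T * d) (\<lambda>j. Rctl T d \<phi> j (ks ! j)) (rev [0..<T])"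
  by (simp add: Ubwd_def mat_chain_def)

lemma Ufwd_unitary:
  "(\<And>j. j < T \<Longrightarrow> unit_vec_c d (\<phi> (ks ! j))) \<Longrightarrow> unitary (2 ^ T * d) (Ufwd T d \<phi> ks)"
  unfolding Ufwd_eq_mat_chain by (intro mat_chain_unitary Rctl_unitary) auto

lemma Ubwd_eq_adjoint:
  "(\<And>j. j < T \<Longrightarrow> unit_vec_c d (\<phi> (ks ! j))) \<Longrightarrow> Ubwd T d \<phi> ks = mat_adjoint (Ufwd T d \<phi> ks)"
  unfolding Ufwd_eq_mat_chain Ubwd_eq_mat_chain
  by (intro mat_chain_rev) (auto intro: Rctl_carrier Rctl_adjoint)

text \<open>The first ancilla is the leftmost tensor factor and meets only the first gate; the later
  gates, with indices shifted by one, form the circuit on the other \<open>T\<close>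
  ancillas.\<close>

lemma Ufwd_Cons:
  assumes "\<And>j. j < Suc T \<Longrightarrow> unit_vec_c d (\<phi> ((k # ks) ! j))"
  shows "Ufwd (Suc T) d \<phi> (k # ks) = kron (1\<^sub>m 2) (Ufwd T d \<phi> ks) * Rctl (Suc T) d \<phi> 0 k"
proof -
  have u: "unit_vec_c d (\<phi> (ks ! j))" if "j < T" for j using assms[of "Suc j"] that by simp
  let ?G = "\<lambda>j. Rctl (Suc T) d \<phi> j ((k # ks) ! j)"
  have "Ufwd (Suc T) d \<phi> (k # ks) = mat_chain (2 ^ Suc T * d) ?G (0 # map Suc [0..<T])"
    unfolding Ufwd_eq_mat_chain by (simp only: map_Suc_upt upt_conv_Cons[of 0 "Suc T"] zero_less_Suc)
  also have "\<dots> = mat_chain (2 ^ Suc T * d) ?G (map Suc [0..<T]) * ?G 0"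
  proof (rule mat_chain_Cons)
    fix j' assume "j' \<in> set (0 # map Suc [0..<T])"
    then have "j' < Suc T" by auto
    then show "?G j' \<in> carrier_mat (2 ^ Suc T * d) (2 ^ Suc T * d)"
      using assms by (intro Rctl_carrier)
  qed
  also have "mat_chain (2 ^ Suc T * d) ?G (map Suc [0..<T])
      = mat_chain (2 ^ Suc T * d) (\<lambda>j. kron (1\<^sub>m 2) (Rctl T d \<phi> j (ks ! j))) [0..<T]"
    unfolding mat_chain_map using u by (intro mat_chain_cong) (auto intro!: Rctl_Suc simp: unit_vec_c_def)
  also have "\<dots> = kron (1\<^sub>m 2) (Ufwd T d \<phi> ks)"
    unfolding Ufwd_eq_mat_chain using u
    by (simp only: power_Suc mult.assoc) (intro mat_chain_kron Rctl_carrier, auto)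
  finally show ?thesis by simp
qed

text \<open>The isometry \<open>|->\<^sup>\<otimes>\<^sup>T \<otimes> I\<close> that adjoins the ancillas to the system.\<close>

definition minus_col :: "complex mat" where
  "minus_col = mat 2 1 (\<lambda>(i, j). ket_minus $ i)"

definition anc :: "nat \<Rightarrow> nat \<Rightarrow> complex mat" where
  "anc T d = kron (kpow minus_col T) (1\<^sub>m d)"

lemma dim_minus_col [simp]: "dim_row minus_col = 2" "dim_col minus_col = Suc 0"
  by (auto simp: minus_col_def)

lemma dim_anc [simp]: "dim_row (anc T d) = 2 ^ T * d" "dim_col (anc T d) = d"
  by (auto simp: anc_def)

lemma outer_ket_minus: "outer ket_minus ket_minus = minus_col * mat_adjoint minus_col"
  by (rule eq_matI) (auto simp: outer_def minus_col_def mult_mat_index_sum simp del: index_mult_mat(1))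

lemma inverse_sqrt2_square: "complex_of_real (sqrt 2) * complex_of_real (sqrt 2) = 2"
  by (simp flip: of_real_mult)

lemma minus_col_normalised: "mat_adjoint minus_col * minus_col = 1\<^sub>m (Suc 0)"
  by (rule eq_matI)
    (auto simp: minus_col_def mult_mat_index_sum ket_minus_def numeral_2_eq_2[of] inverse_sqrt2_square
      simp del: index_mult_mat(1))

text \<open>Each computational projector has weight 1/2 in |->. These weights turn the identity and
  the reflection into their mean in \<open>miss_op_Cons\<close>.\<close>

lemma minus_col_expectation:
  "mat_adjoint minus_col * (outer ket0 ket0 * minus_col) = (1 / 2) \<cdot>\<^sub>m 1\<^sub>m (Suc 0)"
  "mat_adjoint minus_col * (outer ket1 ket1 * minus_col) = (1 / 2) \<cdot>\<^sub>m 1\<^sub>m (Suc 0)"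
  by (rule eq_matI; auto simp: minus_col_def mult_mat_index_sum ket_minus_def outer_def ket0_def ket1_def
      numeral_2_eq_2 inverse_sqrt2_square simp del: index_mult_mat(1))+

lemma anc_isometry: "mat_adjoint (anc T d) * anc T d = 1\<^sub>m d"
  by (simp add: anc_def kron_adjoint kron_mult kpow_adjoint minus_col_normalised flip: kpow_mult)

text \<open>The first outcome projects onto the range of an isometry, so a trace against it
  compresses operators to the system alone.\<close>

lemma Meas1_eq: "Meas1 T d = anc T d * mat_adjoint (anc T d)"
  by (simp add: Meas1_def anc_def outer_ket_minus kron_adjoint kron_mult kpow_mult kpow_adjoint)

lemma kron_anc_state:
  "\<rho> \<in> carrier_mat d d \<Longrightarrow> kron (kpow (outer ket_minus ket_minus) T) \<rho> = anc T d * \<rho> * mat_adjoint (anc T d)"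
proof -
  assume \<rho>: "\<rho> \<in> carrier_mat d d"
  \<comment> \<open>A 1-by-1 identity is inserted in front of \<open>\<rho>\<close>, so that all
    three factors are Kronecker products and \<open>kron_mult\<close> applies.\<close>
  then have "anc T d * \<rho> * mat_adjoint (anc T d)
      = kron (kpow minus_col T) (1\<^sub>m d) * kron (1\<^sub>m (Suc 0)) \<rho> * kron (kpow (mat_adjoint minus_col) T) (1\<^sub>m d)"
    by (simp add: anc_def kron_adjoint kpow_adjoint)
  also have "\<dots> = kron (kpow minus_col T * kpow (mat_adjoint minus_col) T) \<rho>"
    using \<rho> by (simp add: kron_mult del: kron_one_1_left)
  finally show ?thesis by (simp add: outer_ket_minus kpow_mult)
qed

text \<open>The operator by which the all-\<open>|->\<close> outcome acts on the system.\<close>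

definition miss_op :: "nat \<Rightarrow> nat \<Rightarrow> (nat \<Rightarrow> complex vec) \<Rightarrow> nat list \<Rightarrow> complex mat" where
  "miss_op T d \<phi> ks = mat_adjoint (anc T d) * Ufwd T d \<phi> ks * anc T d"

lemma miss_op_Nil: "miss_op 0 d \<phi> [] = 1\<^sub>m d"
  by (simp add: miss_op_def Ufwd_def anc_def)

text \<open>Compressing the first ancilla to |-> averages the identity and the reflection, and
  \<open>(I + (I - 2 P)) / 2 = I - P\<close>. Only expectations in |-> enter, so |+> never has to be
  introduced. The new factor stands on the right because its gate acts first.\<close>

lemma miss_op_Cons:
  assumes "\<And>j. j < Suc T \<Longrightarrow> unit_vec_c d (\<phi> ((k # ks) ! j))"
  shows "miss_op (Suc T) d \<phi> (k # ks) = miss_op T d \<phi> ks * (1\<^sub>m d - outer (\<phi> k) (\<phi> k))"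
proof -
  have u: "unit_vec_c d (\<phi> (ks ! j))" if "j < T" for j using assms[of "Suc j"] that by simp
  have v: "unit_vec_c d (\<phi> k)" using assms[of 0] by simp
  then have [simp]: "dim_vec (\<phi> k) = d" by (auto simp: unit_vec_c_def)
  define U where "U = Ufwd T d \<phi> ks"
  have [simp]: "dim_row U = 2 ^ T * d" "dim_col U = 2 ^ T * d"
    using unitary_carrier[OF Ufwd_unitary[of T d \<phi> ks, OF u]] by (auto simp: U_def)
  define V where "V = anc T d"
  have [simp]: "dim_row V = 2 ^ T * d" "dim_col V = d" by (auto simp: V_def)
  have UC: "Ufwd (Suc T) d \<phi> (k # ks) = kron (1\<^sub>m 2) U * Rctl (Suc T) d \<phi> 0 k"
    unfolding U_def by (rule Ufwd_Cons) (rule assms)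
  have V': "anc (Suc T) d = kron minus_col V" by (simp add: anc_def V_def kron_assoc)
  let ?r = "refl d (\<phi> k)"
  let ?L = "mat_adjoint V * U * V"
  have R0: "Rctl (Suc T) d \<phi> 0 k = kron (outer ket0 ket0) (1\<^sub>m (2 ^ T * d))
      + kron (outer ket1 ket1) (kron (1\<^sub>m (2 ^ T)) ?r)"
    by (simp add: Rctl_def qop_0 kron_assoc kron_one)
  \<comment> \<open>An operator on the system alone can be moved past the adjoined ancillas.\<close>
  have rV: "kron (1\<^sub>m (2 ^ T)) ?r * V = V * ?r"
  proof -
    have "V * ?r = kron (kpow minus_col T) (1\<^sub>m d) * kron (1\<^sub>m (Suc 0)) ?r"
      by (simp add: V_def anc_def)
    also have "\<dots> = kron (kpow minus_col T) ?r"
      by (simp add: kron_mult right_mult_one_mat[of _ _ "Suc 0"] carrier_matI left_mult_one_mat[of _ _ d]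
          del: kron_one_1_left)
    also have "\<dots> = kron (1\<^sub>m (2 ^ T)) ?r * V"
      by (simp add: V_def anc_def kron_mult right_mult_one_mat[of _ _ d] left_mult_one_mat[of _ "2 ^ T"] carrier_matI)
    finally show ?thesis by simp
  qed
  have "Rctl (Suc T) d \<phi> 0 k * kron minus_col V = kron (outer ket0 ket0 * minus_col) V
      + kron (outer ket1 ket1 * minus_col) (V * ?r)"
    unfolding R0
    by (subst add_mult_distrib_mat[of _ "2 ^ Suc T * d" "2 ^ Suc T * d" _ _ d])
      (auto simp: kron_mult rV carrier_matI)
  moreover have "mat_adjoint (kron minus_col V) * kron (1\<^sub>m 2) U = kron (mat_adjoint minus_col) (mat_adjoint V * U)"
    by (simp add: kron_adjoint kron_mult right_mult_one_mat[of _ _ "2"] carrier_matI)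
  moreover have "miss_op (Suc T) d \<phi> (k # ks) =
      (mat_adjoint (kron minus_col V) * kron (1\<^sub>m 2) U) * (Rctl (Suc T) d \<phi> 0 k * kron minus_col V)"
    unfolding miss_op_def V' UC
    using Rctl_carrier[of 0 "Suc T" d \<phi> k, OF _ v]
    by (simp add: mult_assoc_dim mult.assoc)
  ultimately have "miss_op (Suc T) d \<phi> (k # ks) = kron (mat_adjoint minus_col) (mat_adjoint V * U) *
      (kron (outer ket0 ket0 * minus_col) V + kron (outer ket1 ket1 * minus_col) (V * ?r))"
    by simp
  also have "\<dots> = (1 / 2) \<cdot>\<^sub>m ?L + (1 / 2) \<cdot>\<^sub>m (?L * ?r)"
    by (subst mult_add_distrib_mat[of _ d "2 ^ Suc T * d" _ d])
      (auto simp: kron_mult minus_col_expectation kron_smult_left mult_assoc_dim carrier_matI)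
  also have "\<dots> = (1 / 2) \<cdot>\<^sub>m (?L * (1\<^sub>m d + ?r))"
    by (subst mult_add_distrib_mat[of _ d d _ d]) (auto simp: add_smult_distrib_left_mat[of _ d d] carrier_matI)
  also have "\<dots> = ?L * ((1 / 2) \<cdot>\<^sub>m (1\<^sub>m d + ?r))"
    by (subst mult_smult_distrib[of _ d d _ d]) (auto simp: carrier_matI)
  also have "(1 / 2) \<cdot>\<^sub>m (1\<^sub>m d + ?r) = 1\<^sub>m d - outer (\<phi> k) (\<phi> k)"
    by (rule eq_matI) (auto simp: refl_def)
  finally show ?thesis by (simp add: miss_op_def V_def U_def)
qed

subsection \<open>Averaged operators\<close>

text \<open>Cauchy-Schwarz for squared moduli, used twice: with coefficients 1 to bound the norm of
  an average, and with the amplitudes of the all-|-> state to discard Kraus operators.\<close>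

lemma cmod_sum_mult_le:
  "(cmod (\<Sum>x\<in>I. a x * z x))\<^sup>2 \<le> (\<Sum>x\<in>I. (cmod (a x))\<^sup>2) * (\<Sum>x\<in>I. (cmod (z x))\<^sup>2)"
proof -
  have "cmod (\<Sum>x\<in>I. a x * z x) \<le> (\<Sum>x\<in>I. \<bar>cmod (a x)\<bar> * \<bar>cmod (z x)\<bar>)"
    by (rule order_trans[OF norm_sum]) (simp add: norm_mult)
  also have "\<dots> \<le> L2_set (\<lambda>x. cmod (a x)) I * L2_set (\<lambda>x. cmod (z x)) I"
    by (rule L2_set_mult_ineq)
  finally have "(cmod (\<Sum>x\<in>I. a x * z x))\<^sup>2 \<le> (L2_set (\<lambda>x. cmod (a x)) I * L2_set (\<lambda>x. cmod (z x)) I)\<^sup>2"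
    by (rule power_mono) simp
  then show ?thesis by (simp add: power_mult_distrib L2_set_def sum_nonneg)
qed

text \<open>Entrywise with the dimension \<open>n\<close> explicit, so that the empty sum is the
  \<open>n\<close>-by-\<open>n\<close> zero matrix.\<close>

definition msum :: "nat \<Rightarrow> ('a \<Rightarrow> complex mat) \<Rightarrow> 'a set \<Rightarrow> complex mat" where
  "msum n A I = mat n n (\<lambda>(i, j). \<Sum>x\<in>I. A x $$ (i, j))"

lemma dim_msum [simp]: "dim_row (msum n A I) = n" "dim_col (msum n A I) = n"
  by (auto simp: msum_def)

lemma msum_cong: "(\<And>x. x \<in> I \<Longrightarrow> A x = B x) \<Longrightarrow> msum n A I = msum n B I"
  by (auto simp: msum_def intro!: eq_matI sum.cong)

lemma msum_mult_left:
  assumes "R \<in> carrier_mat n n" "\<And>x. x \<in> I \<Longrightarrow> A x \<in> carrier_mat n n"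
  shows "R * msum n A I = msum n (\<lambda>x. R * A x) I"
proof (rule eq_matI)
  fix i j assume "i < dim_row (msum n (\<lambda>x. R * A x) I)" "j < dim_col (msum n (\<lambda>x. R * A x) I)"
  then have ij: "i < n" "j < n" by auto
  have "(R * msum n A I) $$ (i, j) = (\<Sum>k<n. \<Sum>x\<in>I. R $$ (i, k) * A x $$ (k, j))"
    using assms(1) ij by (auto simp: mult_mat_index_sum msum_def sum_distrib_left simp del: index_mult_mat(1))
  also have "\<dots> = (\<Sum>x\<in>I. \<Sum>k<n. R $$ (i, k) * A x $$ (k, j))" by (rule sum.swap)
  also have "\<dots> = (\<Sum>x\<in>I. (R * A x) $$ (i, j))"
  proof (rule sum.cong[OF refl])
    fix x assume "x \<in> I"
    with assms(2) have "dim_row (A x) = n" "dim_col (A x) = n" by auto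
    then show "(\<Sum>k<n. R $$ (i, k) * A x $$ (k, j)) = (R * A x) $$ (i, j)"
      using assms(1) ij by (subst mult_mat_index_sum) auto
  qed
  finally show "(R * msum n A I) $$ (i, j) = msum n (\<lambda>x. R * A x) I $$ (i, j)"
    using ij by (simp add: msum_def)
qed (use assms in auto)

lemma msum_adjoint:
  assumes "\<And>x. x \<in> I \<Longrightarrow> A x \<in> carrier_mat n n"
  shows "mat_adjoint (msum n A I) = msum n (\<lambda>x. mat_adjoint (A x)) I"
proof (rule eq_matI)
  fix i j assume ij: "i < dim_row (msum n (\<lambda>x. mat_adjoint (A x)) I)" "j < dim_col (msum n (\<lambda>x. mat_adjoint (A x)) I)"
  have "(\<Sum>x\<in>I. cnj (A x $$ (j, i))) = (\<Sum>x\<in>I. mat_adjoint (A x) $$ (i, j))"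
    using assms ij by (intro sum.cong) (auto dest!: assms)
  then show "mat_adjoint (msum n A I) $$ (i, j) = msum n (\<lambda>x. mat_adjoint (A x)) I $$ (i, j)"
    using ij by (simp add: msum_def)
qed auto

lemma msum_mult_vec_index:
  assumes "v \<in> carrier_vec n" "i < n" "\<And>x. x \<in> I \<Longrightarrow> A x \<in> carrier_mat n n"
  shows "(msum n A I *\<^sub>v v) $ i = (\<Sum>x\<in>I. (A x *\<^sub>v v) $ i)"
proof -
  have "(msum n A I *\<^sub>v v) $ i = (\<Sum>k<n. \<Sum>x\<in>I. A x $$ (i, k) * v $ k)"
    using assms(1,2) by (auto simp: mult_mat_vec_index_sum msum_def sum_distrib_right simp del: index_mult_mat_vec)
  also have "\<dots> = (\<Sum>x\<in>I. \<Sum>k<n. A x $$ (i, k) * v $ k)" by (rule sum.swap)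
  also have "\<dots> = (\<Sum>x\<in>I. (A x *\<^sub>v v) $ i)"
  proof (rule sum.cong[OF refl])
    fix x assume "x \<in> I"
    with assms(3) have "dim_row (A x) = n" "dim_col (A x) = n" by auto
    then show "(\<Sum>k<n. A x $$ (i, k) * v $ k) = (A x *\<^sub>v v) $ i"
      using assms(1,2) by (subst mult_mat_vec_index_sum) auto
  qed
  finally show ?thesis .
qed

lemma cinner_msum:
  assumes "v \<in> carrier_vec n" "\<And>x. x \<in> I \<Longrightarrow> A x \<in> carrier_mat n n"
  shows "cinner v (msum n A I *\<^sub>v v) = (\<Sum>x\<in>I. cinner v (A x *\<^sub>v v))"
proof -
  have "cinner v (msum n A I *\<^sub>v v) = (\<Sum>i<n. \<Sum>x\<in>I. cnj (v $ i) * (A x *\<^sub>v v) $ i)"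
    using assms by (auto simp: cinner_sum msum_mult_vec_index sum_distrib_left simp del: index_mult_mat_vec)
  also have "\<dots> = (\<Sum>x\<in>I. \<Sum>i<n. cnj (v $ i) * (A x *\<^sub>v v) $ i)" by (rule sum.swap)
  also have "\<dots> = (\<Sum>x\<in>I. cinner v (A x *\<^sub>v v))"
  proof (rule sum.cong[OF refl])
    fix x assume "x \<in> I"
    with assms(2) have "dim_row (A x) = n" by auto
    then show "(\<Sum>i<n. cnj (v $ i) * (A x *\<^sub>v v) $ i) = cinner v (A x *\<^sub>v v)"
      using assms(1) by (subst cinner_sum) auto
  qed
  finally show ?thesis .
qed

lemma ctrace_msum:
  assumes "\<And>x. x \<in> I \<Longrightarrow> A x \<in> carrier_mat n n"
  shows "ctrace (msum n A I) = (\<Sum>x\<in>I. ctrace (A x))"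
proof -
  have "ctrace (msum n A I) = (\<Sum>i<n. \<Sum>x\<in>I. A x $$ (i, i))" by (simp add: ctrace_def msum_def)
  also have "\<dots> = (\<Sum>x\<in>I. \<Sum>i<n. A x $$ (i, i))" by (rule sum.swap)
  also have "\<dots> = (\<Sum>x\<in>I. ctrace (A x))"
    unfolding ctrace_def using assms by (intro sum.cong) auto
  finally show ?thesis .
qed

lemma psd_msum: "(\<And>x. x \<in> I \<Longrightarrow> psd n (A x)) \<Longrightarrow> psd n (msum n A I)"
proof -
  assume A: "\<And>x. x \<in> I \<Longrightarrow> psd n (A x)"
  then have c: "\<And>x. x \<in> I \<Longrightarrow> A x \<in> carrier_mat n n" by (rule psdD(1))
  have "mat_adjoint (msum n A I) = msum n (\<lambda>x. mat_adjoint (A x)) I" by (rule msum_adjoint) (rule c)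
  also have "\<dots> = msum n A I" by (rule msum_cong) (rule psdD(4)[OF A])
  finally have "mat_adjoint (msum n A I) = msum n A I" .
  moreover have "0 \<le> Re (cinner v (msum n A I *\<^sub>v v)) \<and> Im (cinner v (msum n A I *\<^sub>v v)) = 0"
    if v: "v \<in> carrier_vec n" for v
  proof -
    have "cinner v (msum n A I *\<^sub>v v) = (\<Sum>x\<in>I. cinner v (A x *\<^sub>v v))" by (rule cinner_msum[OF v]) (rule c)
    moreover have "0 \<le> Re (cinner v (A x *\<^sub>v v)) \<and> Im (cinner v (A x *\<^sub>v v)) = 0" if "x \<in> I" for x
      using A[OF that] v by (simp add: psd_def)
    ultimately show ?thesis by (simp add: sum_nonneg)
  qed
  ultimately show ?thesis by (simp add: psd_def carrier_matI)
qed

lemma psd_add: "psd n A \<Longrightarrow> psd n B \<Longrightarrow> psd n (A + B)"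
  by (auto simp: psd_def mat_adjoint_add add_mult_distrib_mat_vec[of _ n n] cinner_add_right)

lemma cinner_smult_mat:
  assumes "A \<in> carrier_mat n n" "v \<in> carrier_vec n"
  shows "cinner v ((c \<cdot>\<^sub>m A) *\<^sub>v v) = c * cinner v (A *\<^sub>v v)"
proof -
  have "(c \<cdot>\<^sub>m A) *\<^sub>v v = c \<cdot>\<^sub>v (A *\<^sub>v v)" using assms by (intro eq_vecI) auto
  then show ?thesis using assms by (simp add: cinner_smult_right)
qed

lemma psd_smult: "psd n A \<Longrightarrow> 0 \<le> c \<Longrightarrow> psd n (complex_of_real c \<cdot>\<^sub>m A)"
  by (auto simp: psd_def mat_adjoint_smult cinner_smult_mat)

text \<open>\<open>fidelity_ge\<close> is applied to the average \<open>C\<close> of the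
  \<open>B x\<close>. Its domination hypothesis follows because the squared norm of an average is at
  most the average of the squared norms.\<close>

lemma fidelity_ge_average:
  assumes "psd n \<sigma>" "psd n \<rho>" "finite I" "I \<noteq> {}"
    and B: "\<And>x. x \<in> I \<Longrightarrow> B x \<in> carrier_mat n n" "\<And>x. x \<in> I \<Longrightarrow> mat_adjoint (B x) = B x"
    and dom: "\<And>v. v \<in> carrier_vec n \<Longrightarrow>
      (\<Sum>x\<in>I. vnorm2 (msqrt \<rho> *\<^sub>v (B x *\<^sub>v v))) / card I \<le> Re (cinner v (\<sigma> *\<^sub>v v))"
  shows "(\<Sum>x\<in>I. Re (ctrace (B x * \<rho>))) / card I \<le> fidelity \<sigma> \<rho>"
proof -
  define r where "r = msqrt \<rho>"
  note r = psdD[OF msqrt_props(1)[OF assms(2), folded r_def]]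
  note r2 = msqrt_props(2)[OF assms(2), folded r_def]
  note rho = psdD[OF assms(2)]
  define N where "N = real (card I)"
  have N: "0 < N" using assms(3,4) by (simp add: N_def card_gt_0_iff)
  define S where "S = msum n B I"
  have S: "S \<in> carrier_mat n n" "dim_row S = n" "dim_col S = n" by (auto simp: S_def carrier_matI)
  have Sadj: "mat_adjoint S = S"
    using B(2) unfolding S_def by (subst msum_adjoint[OF B(1)]) (auto intro!: msum_cong)
  define C where "C = complex_of_real (1 / N) \<cdot>\<^sub>m S"
  have C: "C \<in> carrier_mat n n" using S by (simp add: C_def)
  have Cadj: "mat_adjoint C = C" by (simp add: C_def mat_adjoint_smult Sadj)
  have rB: "r * B x \<in> carrier_mat n n" if "x \<in> I" for x
    using r(1) B(1)[OF that] by auto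
  have "Re (ctrace (C * \<rho>)) \<le> fidelity \<sigma> \<rho>"
  proof (rule fidelity_ge[OF assms(1,2) C], unfold Cadj)
    fix v :: "complex vec" assume v: "v \<in> carrier_vec n"
    have Cv: "C *\<^sub>v v = complex_of_real (1 / N) \<cdot>\<^sub>v (S *\<^sub>v v)"
      using v S by (intro eq_vecI) (auto simp: C_def)
    have "Re (cinner (C *\<^sub>v v) (\<rho> *\<^sub>v (C *\<^sub>v v))) = vnorm2 (r *\<^sub>v (C *\<^sub>v v))"
      using r C by (subst vnorm2_mult_mat_vec) (auto simp: r2)
    also have "r *\<^sub>v (C *\<^sub>v v) = complex_of_real (1 / N) \<cdot>\<^sub>v (msum n (\<lambda>x. r * B x) I *\<^sub>v v)"
    proof -
      have "r *\<^sub>v (C *\<^sub>v v) = complex_of_real (1 / N) \<cdot>\<^sub>v (r *\<^sub>v (S *\<^sub>v v))"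
        unfolding Cv by (rule mult_mat_vec[OF r(1)]) (use S in \<open>auto intro: carrier_vecI\<close>)
      also have "r *\<^sub>v (S *\<^sub>v v) = (r * S) *\<^sub>v v"
        using r S v by (subst mult_vec_assoc_dim) auto
      also have "r * S = msum n (\<lambda>x. r * B x) I"
        unfolding S_def by (rule msum_mult_left[OF r(1) B(1)])
      finally show ?thesis .
    qed
    also have "vnorm2 \<dots> = (\<Sum>i<n. (cmod (\<Sum>x\<in>I. ((r * B x) *\<^sub>v v) $ i))\<^sup>2) / N\<^sup>2"
    proof -
      have "vnorm2 (complex_of_real (1 / N) \<cdot>\<^sub>v (msum n (\<lambda>x. r * B x) I *\<^sub>v v))
          = (\<Sum>i<n. (cmod (complex_of_real (1 / N) * (\<Sum>x\<in>I. ((r * B x) *\<^sub>v v) $ i)))\<^sup>2)"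
        unfolding vnorm2_def by (rule sum.cong) (auto simp: msum_mult_vec_index[OF v _ rB] simp del: index_mult_mat_vec)
      moreover have "(cmod (complex_of_real (1 / N) * w))\<^sup>2 = (cmod w)\<^sup>2 / N\<^sup>2" for w
        using N by (simp add: norm_mult norm_divide power_divide)
      ultimately show ?thesis by (simp only: sum_divide_distrib)
    qed
    \<comment> \<open>Cauchy-Schwarz with coefficients 1 costs a factor \<open>N\<close>, which
      cancels one of the two in the denominator.\<close>
    also have "\<dots> \<le> (\<Sum>i<n. N * (\<Sum>x\<in>I. (cmod (((r * B x) *\<^sub>v v) $ i))\<^sup>2)) / N\<^sup>2"
    proof (intro divide_right_mono sum_mono)
      fix i
      show "(cmod (\<Sum>x\<in>I. ((r * B x) *\<^sub>v v) $ i))\<^sup>2 \<le> N * (\<Sum>x\<in>I. (cmod (((r * B x) *\<^sub>v v) $ i))\<^sup>2)"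
        using cmod_sum_mult_le[of "\<lambda>_. 1" "\<lambda>x. ((r * B x) *\<^sub>v v) $ i" I] by (simp add: N_def del: index_mult_mat_vec)
    qed simp
    also have "\<dots> = (\<Sum>i<n. \<Sum>x\<in>I. (cmod (((r * B x) *\<^sub>v v) $ i))\<^sup>2) / N"
      using N by (simp add: sum_distrib_left[symmetric] power2_eq_square del: index_mult_mat_vec)
    also have "(\<Sum>i<n. \<Sum>x\<in>I. (cmod (((r * B x) *\<^sub>v v) $ i))\<^sup>2)
        = (\<Sum>x\<in>I. \<Sum>i<n. (cmod (((r * B x) *\<^sub>v v) $ i))\<^sup>2)" by (rule sum.swap)
    also have "\<dots> = (\<Sum>x\<in>I. vnorm2 (r *\<^sub>v (B x *\<^sub>v v)))"
    proof (rule sum.cong[OF refl])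
      fix x assume "x \<in> I"
      with B(1) have "dim_row (B x) = n" "dim_col (B x) = n" by auto
      then have "(r * B x) *\<^sub>v v = r *\<^sub>v (B x *\<^sub>v v)" using r v by (subst mult_vec_assoc_dim) auto
      then show "(\<Sum>i<n. (cmod (((r * B x) *\<^sub>v v) $ i))\<^sup>2) = vnorm2 (r *\<^sub>v (B x *\<^sub>v v))"
        using r by (simp add: vnorm2_def del: index_mult_mat_vec)
    qed
    finally show "Re (cinner (C *\<^sub>v v) (\<rho> *\<^sub>v (C *\<^sub>v v))) \<le> Re (cinner v (\<sigma> *\<^sub>v v))"
      using dom[OF v] by (simp add: N_def r_def)
  qed
  moreover have "Re (ctrace (C * \<rho>)) = (\<Sum>x\<in>I. Re (ctrace (B x * \<rho>))) / N"
  proof -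
    have "C * \<rho> = complex_of_real (1 / N) \<cdot>\<^sub>m (S * \<rho>)"
      unfolding C_def by (rule mult_smult_assoc_mat[OF S(1) rho(1)])
    then have "ctrace (C * \<rho>) = complex_of_real (1 / N) * ctrace (S * \<rho>)"
      using S by (simp add: ctrace_def sum_distrib_left rho del: index_mult_mat(1))
    also have "ctrace (S * \<rho>) = ctrace (\<rho> * S)" using S rho by (simp add: ctrace_cyclic)
    also have "\<dots> = (\<Sum>x\<in>I. ctrace (\<rho> * B x))"
      unfolding S_def using rho(1) B(1) by (simp add: msum_mult_left ctrace_msum)
    also have "\<dots> = (\<Sum>x\<in>I. ctrace (B x * \<rho>))"
    proof (rule sum.cong[OF refl])
      fix x assume "x \<in> I"
      with B(1) have "dim_row (B x) = n" "dim_col (B x) = n" by auto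
      then show "ctrace (\<rho> * B x) = ctrace (B x * \<rho>)" using rho by (intro ctrace_cyclic) auto
    qed
    finally show ?thesis by simp
  qed
  ultimately show ?thesis by (simp add: N_def)
qed

subsection \<open>Partial trace over the ancillas\<close>

text \<open>\<open>Z\<close> with the ancillas contracted against the computational basis state
  \<open>x\<close>.\<close>

definition row_block :: "nat \<Rightarrow> complex mat \<Rightarrow> nat \<Rightarrow> complex mat" where
  "row_block d Z x = mat d (dim_col Z) (\<lambda>(i, c). Z $$ (x * d + i, c))"

lemma dim_row_block [simp]: "dim_row (row_block d Z x) = d" "dim_col (row_block d Z x) = dim_col Z"
  by (auto simp: row_block_def)

lemma block_index_less: "x < m \<Longrightarrow> i < d \<Longrightarrow> x * d + i < m * (d::nat)"
proof -
  assume "x < m" "i < d"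
  then have "x * d + i < Suc x * d" by simp
  also have "\<dots> \<le> m * d" using \<open>x < m\<close> by (intro mult_le_mono1) simp
  finally show ?thesis .
qed

text \<open>The operator-sum form of the partial trace: the block rows of \<open>Z\<close> play the
  role of Kraus operators in the computational basis of the ancillas.\<close>

lemma ptrace_mult_adjoint:
  assumes "dim_row Z = 2 ^ T * d"
  shows "ptrace_anc T d (Z * mat_adjoint Z) =
    msum d (\<lambda>x. row_block d Z x * mat_adjoint (row_block d Z x)) {..<2 ^ T}"
proof (rule eq_matI)
  fix i j assume "i < dim_row (msum d (\<lambda>x. row_block d Z x * mat_adjoint (row_block d Z x)) {..<2 ^ T})"
    "j < dim_col (msum d (\<lambda>x. row_block d Z x * mat_adjoint (row_block d Z x)) {..<2 ^ T})"
  then have ij: "i < d" "j < d" by auto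
  have "(Z * mat_adjoint Z) $$ (x * d + i, x * d + j) = (row_block d Z x * mat_adjoint (row_block d Z x)) $$ (i, j)"
    if "x < 2 ^ T" for x
    using that ij assms block_index_less[OF that ij(1)] block_index_less[OF that ij(2)]
    by (simp add: mult_mat_index_sum del: index_mult_mat(1)) (simp add: row_block_def)
  then show "ptrace_anc T d (Z * mat_adjoint Z) $$ (i, j) =
      msum d (\<lambda>x. row_block d Z x * mat_adjoint (row_block d Z x)) {..<2 ^ T} $$ (i, j)"
    using ij by (simp add: ptrace_anc_def msum_def del: index_mult_mat(1))
qed (auto simp: ptrace_anc_def)

lemma ptrace_add:
  assumes "A \<in> carrier_mat (2 ^ T * d) (2 ^ T * d)" "B \<in> carrier_mat (2 ^ T * d) (2 ^ T * d)"
  shows "ptrace_anc T d (A + B) = ptrace_anc T d A + ptrace_anc T d B"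
  using assms by (intro eq_matI) (auto simp: ptrace_anc_def block_index_less sum.distrib)

lemma psd_mult_adjoint: "dim_row A = n \<Longrightarrow> psd n (A * mat_adjoint A)"
  using mult_adjoint_psd[of "mat_adjoint A" "dim_col A" n] by (auto intro: carrier_matI)

lemma ptrace_mult_adjoint_psd:
  "dim_row Z = 2 ^ T * d \<Longrightarrow> psd d (ptrace_anc T d (Z * mat_adjoint Z))"
  by (subst ptrace_mult_adjoint) (auto intro!: psd_msum psd_mult_adjoint)

lemma kpow_minus_col_normalised: "(\<Sum>x<2 ^ T. (cmod (kpow minus_col T $$ (x, 0)))\<^sup>2) = 1"
proof -
  have "mat_adjoint (kpow minus_col T) * kpow minus_col T = 1\<^sub>m (Suc 0)"
    by (simp add: kpow_adjoint minus_col_normalised flip: kpow_mult)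
  then have "(mat_adjoint (kpow minus_col T) * kpow minus_col T) $$ (0, 0) = 1" by simp
  then have "(\<Sum>x<2 ^ T. cnj (kpow minus_col T $$ (x, 0)) * kpow minus_col T $$ (x, 0)) = 1"
    by (simp add: mult_mat_index_sum del: index_mult_mat(1))
  then have "complex_of_real (\<Sum>x<2 ^ T. (cmod (kpow minus_col T $$ (x, 0)))\<^sup>2) = 1"
    unfolding of_real_sum by (simp add: complex_norm_square mult.commute del: of_real_power)
  then show ?thesis by (simp only: of_real_eq_1_iff)
qed

lemma adjoint_anc_mult_index:
  assumes "dim_row Z = 2 ^ T * d" "i < d" "c < dim_col Z"
  shows "(mat_adjoint (anc T d) * Z) $$ (i, c) =
    (\<Sum>x<2 ^ T. cnj (kpow minus_col T $$ (x, 0)) * row_block d Z x $$ (i, c))"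
proof -
  \<comment> \<open>The summand is phrased through \<open>y div d\<close> and \<open>y mod d\<close>
    to match \<open>sum_div_mod\<close>; the \<open>if\<close> is the identity factor of
    \<open>anc\<close>.\<close>
  have "(mat_adjoint (anc T d) * Z) $$ (i, c) = (\<Sum>y<2 ^ T * d. (\<lambda>x i'.
      cnj (kpow minus_col T $$ (x, 0)) * (if i' = i then 1 else 0) * Z $$ (x * d + i', c)) (y div d) (y mod d))"
    using assms
    by (auto simp: mult_mat_index_sum anc_def less_mult_imp_div_less mod_less_of_less_mult
        simp del: index_mult_mat(1) intro!: sum.cong)
  also have "\<dots> = (\<Sum>x<2 ^ T. \<Sum>i'<d.
      cnj (kpow minus_col T $$ (x, 0)) * (if i' = i then 1 else 0) * Z $$ (x * d + i', c))"
    by (rule sum_div_mod)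
  also have "\<dots> = (\<Sum>x<2 ^ T. cnj (kpow minus_col T $$ (x, 0)) * row_block d Z x $$ (i, c))"
  proof (rule sum.cong[OF refl])
    fix x
    have "(\<Sum>i'<d. cnj (kpow minus_col T $$ (x, 0)) * (if i' = i then 1 else 0) * Z $$ (x * d + i', c))
        = (\<Sum>i'<d. if i' = i then cnj (kpow minus_col T $$ (x, 0)) * Z $$ (x * d + i', c) else 0)"
      by (rule sum.cong) auto
    then show "(\<Sum>i'<d. cnj (kpow minus_col T $$ (x, 0)) * (if i' = i then 1 else 0) * Z $$ (x * d + i', c))
        = cnj (kpow minus_col T $$ (x, 0)) * row_block d Z x $$ (i, c)"
      using assms by (simp add: row_block_def)
  qed
  finally show ?thesis .
qed

text \<open>Keeps the one Kraus operator that leaves the ancillas in the all-|-> state. Instead of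
  extending this state to a basis, its component is bounded by Cauchy-Schwarz against the unit
  vector of its amplitudes.\<close>

lemma ptrace_ge_anc:
  assumes Z: "dim_row Z = 2 ^ T * d" and v: "v \<in> carrier_vec d"
  shows "vnorm2 (mat_adjoint (mat_adjoint (anc T d) * Z) *\<^sub>v v)
    \<le> Re (cinner v (ptrace_anc T d (Z * mat_adjoint Z) *\<^sub>v v))"
proof -
  let ?m = "\<lambda>x. kpow minus_col T $$ (x, 0)"
  let ?z = "\<lambda>x. mat_adjoint (row_block d Z x) *\<^sub>v v"
  have comp: "(mat_adjoint (mat_adjoint (anc T d) * Z) *\<^sub>v v) $ c = (\<Sum>x<2 ^ T. ?m x * ?z x $ c)"
    if c: "c < dim_col Z" for c
  proof -
    have "(mat_adjoint (mat_adjoint (anc T d) * Z) *\<^sub>v v) $ c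
        = (\<Sum>i<d. cnj ((mat_adjoint (anc T d) * Z) $$ (i, c)) * v $ i)"
      using v c by (auto simp: mult_mat_vec_index_sum simp del: index_mult_mat_vec index_mult_mat(1))
    also have "\<dots> = (\<Sum>i<d. \<Sum>x<2 ^ T. ?m x * (cnj (row_block d Z x $$ (i, c)) * v $ i))"
      using c by (intro sum.cong) (auto simp: adjoint_anc_mult_index[OF Z] sum_distrib_right mult.assoc
          simp del: index_mult_mat(1))
    also have "\<dots> = (\<Sum>x<2 ^ T. \<Sum>i<d. ?m x * (cnj (row_block d Z x $$ (i, c)) * v $ i))"
      by (rule sum.swap)
    also have "\<dots> = (\<Sum>x<2 ^ T. ?m x * ?z x $ c)"
      using v c by (auto simp: mult_mat_vec_index_sum sum_distrib_left simp del: index_mult_mat_vec)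
    finally show ?thesis .
  qed
  have "vnorm2 (mat_adjoint (mat_adjoint (anc T d) * Z) *\<^sub>v v)
      = (\<Sum>c<dim_col Z. (cmod (\<Sum>x<2 ^ T. ?m x * ?z x $ c))\<^sup>2)"
    by (simp add: vnorm2_def comp del: index_mult_mat_vec)
  also have "\<dots> \<le> (\<Sum>c<dim_col Z. \<Sum>x<2 ^ T. (cmod (?z x $ c))\<^sup>2)"
  proof (rule sum_mono)
    fix c
    show "(cmod (\<Sum>x<2 ^ T. ?m x * ?z x $ c))\<^sup>2 \<le> (\<Sum>x<2 ^ T. (cmod (?z x $ c))\<^sup>2)"
      using cmod_sum_mult_le[of ?m "\<lambda>x. ?z x $ c" "{..<2 ^ T}"] unfolding kpow_minus_col_normalised by simp
  qed
  also have "\<dots> = (\<Sum>x<2 ^ T. \<Sum>c<dim_col Z. (cmod (?z x $ c))\<^sup>2)" by (rule sum.swap)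
  also have "\<dots> = (\<Sum>x<2 ^ T. vnorm2 (?z x))"
    by (simp add: vnorm2_def del: index_mult_mat_vec)
  also have "\<dots> = (\<Sum>x<2 ^ T. Re (cinner v ((row_block d Z x * mat_adjoint (row_block d Z x)) *\<^sub>v v)))"
    using v by (subst vnorm2_mult_mat_vec) auto
  also have "\<dots> = Re (cinner v (ptrace_anc T d (Z * mat_adjoint Z) *\<^sub>v v))"
    unfolding ptrace_mult_adjoint[OF Z] using v by (subst cinner_msum) (auto intro: carrier_matI)
  finally show ?thesis .
qed

subsection \<open>Outcome probabilities and the channel\<close>

lemma dim_miss_op [simp]: "dim_row (miss_op T d \<phi> ks) = d" "dim_col (miss_op T d \<phi> ks) = d"
  by (auto simp: miss_op_def)

text \<open>A square-root factor of the unnormalised state after step (iii) for the measurement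
  operator \<open>M\<close>: thanks to \<open>msqrt \<rho>\<close>, that state is this matrix times
  its adjoint, the form required by \<open>ptrace_ge_anc\<close>.\<close>

definition sandwich :: "nat \<Rightarrow> nat \<Rightarrow> (nat \<Rightarrow> complex vec) \<Rightarrow> nat list \<Rightarrow> complex mat \<Rightarrow> complex mat \<Rightarrow> complex mat" where
  "sandwich T d \<phi> ks \<rho> M = mat_adjoint (Ufwd T d \<phi> ks) * M * Ufwd T d \<phi> ks * anc T d * msqrt \<rho>"

text \<open>The system output for one fixed sequence \<open>ks\<close>; \<open>chan\<close> averages
  these.\<close>

definition out_state :: "nat \<Rightarrow> nat \<Rightarrow> (nat \<Rightarrow> complex vec) \<Rightarrow> nat list \<Rightarrow> complex mat \<Rightarrow> complex mat" where
  "out_state T d \<phi> ks \<rho> = ptrace_anc T d (Ubwd T d \<phi> ks *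
     (Meas1 T d * state_after_i T d \<phi> ks \<rho> * Meas1 T d
      + Meas2 T d * state_after_i T d \<phi> ks \<rho> * Meas2 T d) * mat_adjoint (Ubwd T d \<phi> ks))"

context
  fixes T d :: nat and \<phi> :: "nat \<Rightarrow> complex vec" and ks :: "nat list" and \<rho> :: "complex mat"
  assumes unit: "\<And>j. j < T \<Longrightarrow> unit_vec_c d (\<phi> (ks ! j))" and rho: "psd d \<rho>"
begin

lemma Ufwd_unitary': "unitary (2 ^ T * d) (Ufwd T d \<phi> ks)"
  by (rule Ufwd_unitary) (rule unit)

lemma dim_Ufwd: "dim_row (Ufwd T d \<phi> ks) = 2 ^ T * d" "dim_col (Ufwd T d \<phi> ks) = 2 ^ T * d"
  using unitary_carrier[OF Ufwd_unitary'] by auto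

lemma state_eq: "state_after_i T d \<phi> ks \<rho> =
    Ufwd T d \<phi> ks * (anc T d * \<rho> * mat_adjoint (anc T d)) * mat_adjoint (Ufwd T d \<phi> ks)"
  using psdD(1)[OF rho] by (simp add: state_after_i_def kron_anc_state)

lemma dim_state: "dim_row (state_after_i T d \<phi> ks \<rho>) = 2 ^ T * d" "dim_col (state_after_i T d \<phi> ks \<rho>) = 2 ^ T * d"
  by (simp_all add: state_eq dim_Ufwd)

text \<open>Cyclicity moves the isometry, and then the adjoint of \<open>miss_op\<close>, around the
  trace.\<close>

lemma ctrace_Meas1:
  "ctrace (Meas1 T d * state_after_i T d \<phi> ks \<rho>) =
    ctrace (mat_adjoint (miss_op T d \<phi> ks) * miss_op T d \<phi> ks * \<rho>)"
proof -
  let ?U = "Ufwd T d \<phi> ks" let ?V = "anc T d" let ?L = "miss_op T d \<phi> ks"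
  note [simp] = dim_Ufwd psdD(2,3)[OF rho]
  have "ctrace (Meas1 T d * state_after_i T d \<phi> ks \<rho>)
      = ctrace (?V * (mat_adjoint ?V * ?U * ?V * \<rho> * mat_adjoint ?V * mat_adjoint ?U))"
    by (simp add: Meas1_eq state_eq mult_assoc_dim)
  also have "\<dots> = ctrace (mat_adjoint ?V * ?U * ?V * \<rho> * mat_adjoint ?V * mat_adjoint ?U * ?V)"
    by (rule ctrace_cyclic) auto
  also have "\<dots> = ctrace (?L * \<rho> * mat_adjoint ?L)"
    by (simp add: miss_op_def mat_adjoint_mult mult_assoc_dim)
  also have "\<dots> = ctrace (mat_adjoint ?L * (?L * \<rho>))" by (rule ctrace_cyclic) auto
  finally show ?thesis by (simp add: mult_assoc_dim)
qed

lemma ctrace_state: "ctrace (state_after_i T d \<phi> ks \<rho>) = ctrace \<rho>"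
proof -
  let ?U = "Ufwd T d \<phi> ks" let ?V = "anc T d"
  note [simp] = dim_Ufwd psdD(2,3)[OF rho]
  have "ctrace (state_after_i T d \<phi> ks \<rho>) = ctrace (?U * (?V * \<rho> * mat_adjoint ?V * mat_adjoint ?U))"
    by (simp add: state_eq mult_assoc_dim)
  also have "\<dots> = ctrace (?V * \<rho> * mat_adjoint ?V * mat_adjoint ?U * ?U)" by (rule ctrace_cyclic) auto
  also have "\<dots> = ctrace (?V * \<rho> * mat_adjoint ?V * (mat_adjoint ?U * ?U))" by (simp add: mult_assoc_dim)
  also have "\<dots> = ctrace (?V * (\<rho> * mat_adjoint ?V))"
    using Ufwd_unitary' by (simp add: unitary_def mult_assoc_dim)
  also have "\<dots> = ctrace (\<rho> * mat_adjoint ?V * ?V)" by (rule ctrace_cyclic) auto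
  also have "\<dots> = ctrace \<rho>" using psdD(1)[OF rho] by (simp add: mult_assoc_dim anc_isometry)
  finally show ?thesis .
qed

lemma ctrace_Meas2:
  "ctrace (Meas2 T d * state_after_i T d \<phi> ks \<rho>) =
    ctrace \<rho> - ctrace (Meas1 T d * state_after_i T d \<phi> ks \<rho>)"
proof -
  let ?S = "state_after_i T d \<phi> ks \<rho>" let ?N = "2 ^ T * d"
  have c: "?S \<in> carrier_mat ?N ?N" "Meas1 T d \<in> carrier_mat ?N ?N"
    by (auto simp: dim_state Meas1_eq intro!: carrier_matI)
  have "Meas2 T d * ?S = ?S - Meas1 T d * ?S"
    unfolding Meas2_def using c by (subst minus_mult_distrib_mat[of _ ?N ?N]) auto
  then show ?thesis using c by (simp add: ctrace_minus ctrace_state)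
qed

lemma dim_sandwich: "dim_row (sandwich T d \<phi> ks \<rho> M) = 2 ^ T * d" "dim_col (sandwich T d \<phi> ks \<rho> M) = d"
  using psdD[OF msqrt_props(1)[OF rho]] by (simp_all add: sandwich_def dim_Ufwd)

lemma sandwich_mult_adjoint:
  assumes "M \<in> carrier_mat (2 ^ T * d) (2 ^ T * d)" "mat_adjoint M = M"
  shows "mat_adjoint (Ufwd T d \<phi> ks) * (M * state_after_i T d \<phi> ks \<rho> * M) * Ufwd T d \<phi> ks
    = sandwich T d \<phi> ks \<rho> M * mat_adjoint (sandwich T d \<phi> ks \<rho> M)"
proof -
  note [simp] = dim_Ufwd psdD(2-4)[OF msqrt_props(1)[OF rho]]
  have [simp]: "dim_row M = 2 ^ T * d" "dim_col M = 2 ^ T * d" using assms by auto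
  have "state_after_i T d \<phi> ks \<rho> = Ufwd T d \<phi> ks * (anc T d * (msqrt \<rho> * msqrt \<rho>) * mat_adjoint (anc T d))
      * mat_adjoint (Ufwd T d \<phi> ks)"
    by (simp add: state_eq msqrt_props(2)[OF rho])
  then show ?thesis by (simp add: sandwich_def mat_adjoint_mult mult_assoc_dim assms(2))
qed

lemma Meas_carrier:
  "Meas1 T d \<in> carrier_mat (2 ^ T * d) (2 ^ T * d)" "Meas2 T d \<in> carrier_mat (2 ^ T * d) (2 ^ T * d)"
  by (auto simp: Meas1_eq Meas2_def intro!: carrier_matI)

lemma Meas_adjoint: "mat_adjoint (Meas1 T d) = Meas1 T d" "mat_adjoint (Meas2 T d) = Meas2 T d"
  by (simp_all add: Meas1_eq Meas2_def mat_adjoint_minus mat_adjoint_mult)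

lemma out_state_eq:
  "out_state T d \<phi> ks \<rho> = ptrace_anc T d (sandwich T d \<phi> ks \<rho> (Meas1 T d) * mat_adjoint (sandwich T d \<phi> ks \<rho> (Meas1 T d)))
    + ptrace_anc T d (sandwich T d \<phi> ks \<rho> (Meas2 T d) * mat_adjoint (sandwich T d \<phi> ks \<rho> (Meas2 T d)))"
proof -
  let ?U = "Ufwd T d \<phi> ks" let ?S = "state_after_i T d \<phi> ks \<rho>" let ?N = "2 ^ T * d"
  let ?X1 = "Meas1 T d * ?S * Meas1 T d" let ?X2 = "Meas2 T d * ?S * Meas2 T d"
  have c: "?X1 \<in> carrier_mat ?N ?N" "?X2 \<in> carrier_mat ?N ?N" "?U \<in> carrier_mat ?N ?N" "mat_adjoint ?U \<in> carrier_mat ?N ?N"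
    using Meas_carrier by (auto simp: dim_Ufwd intro!: carrier_matI)
  have "Ubwd T d \<phi> ks = mat_adjoint ?U" by (rule Ubwd_eq_adjoint) (rule unit)
  then have "out_state T d \<phi> ks \<rho> = ptrace_anc T d (mat_adjoint ?U * (?X1 + ?X2) * ?U)"
    by (simp add: out_state_def)
  also have "mat_adjoint ?U * (?X1 + ?X2) * ?U = mat_adjoint ?U * ?X1 * ?U + mat_adjoint ?U * ?X2 * ?U"
    using c by (simp only: mult_add_distrib_mat[OF c(4,1,2)] add_mult_distrib_mat[OF mult_carrier_mat[OF c(4,1)]
        mult_carrier_mat[OF c(4,2)] c(3)])
  finally show ?thesis
    unfolding sandwich_mult_adjoint[OF Meas_carrier(1) Meas_adjoint(1)]
      sandwich_mult_adjoint[OF Meas_carrier(2) Meas_adjoint(2)]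
    by (simp add: ptrace_add carrier_matI dim_sandwich)
qed

lemma psd_out_state: "psd d (out_state T d \<phi> ks \<rho>)"
  unfolding out_state_eq by (intro psd_add ptrace_mult_adjoint_psd) (simp_all add: dim_sandwich)

text \<open>\<open>Meas1\<close> inserts the range projector of \<open>anc\<close>, which splits the
  expression into the adjoint of \<open>miss_op\<close> times \<open>miss_op\<close>. For
  \<open>Meas2\<close> the identity part collapses to \<open>1\<^sub>m d\<close>, because the
  circuit is unitary and \<open>anc\<close> an isometry.\<close>

lemma anc_sandwich:
  "mat_adjoint (anc T d) * sandwich T d \<phi> ks \<rho> (Meas1 T d) = mat_adjoint (miss_op T d \<phi> ks) * miss_op T d \<phi> ks * msqrt \<rho>"
  "mat_adjoint (anc T d) * sandwich T d \<phi> ks \<rho> (Meas2 T d) =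
    (1\<^sub>m d - mat_adjoint (miss_op T d \<phi> ks) * miss_op T d \<phi> ks) * msqrt \<rho>"
proof -
  let ?U = "Ufwd T d \<phi> ks" let ?V = "anc T d" let ?L = "miss_op T d \<phi> ks" let ?N = "2 ^ T * d"
  note [simp] = dim_Ufwd psdD(2-4)[OF msqrt_props(1)[OF rho]]
  show "mat_adjoint ?V * sandwich T d \<phi> ks \<rho> (Meas1 T d) = mat_adjoint ?L * ?L * msqrt \<rho>"
    by (simp add: sandwich_def miss_op_def Meas1_eq mat_adjoint_mult mult_assoc_dim)
  have UV: "?U * ?V \<in> carrier_mat ?N d" by (auto intro!: carrier_matI)
  have "Meas2 T d * (?U * ?V) = ?U * ?V - Meas1 T d * (?U * ?V)"
    unfolding Meas2_def using Meas_carrier(1) UV by (subst minus_mult_distrib_mat[of _ ?N ?N]) auto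
  moreover have "mat_adjoint ?V * sandwich T d \<phi> ks \<rho> (Meas2 T d)
      = (mat_adjoint ?V * mat_adjoint ?U) * (Meas2 T d * (?U * ?V)) * msqrt \<rho>"
    using Meas_carrier(2) by (simp add: sandwich_def mult_assoc_dim)
  ultimately have "mat_adjoint ?V * sandwich T d \<phi> ks \<rho> (Meas2 T d)
      = (mat_adjoint ?V * mat_adjoint ?U) * (?U * ?V - Meas1 T d * (?U * ?V)) * msqrt \<rho>" by simp
  also have "(mat_adjoint ?V * mat_adjoint ?U) * (?U * ?V - Meas1 T d * (?U * ?V))
      = (mat_adjoint ?V * mat_adjoint ?U) * (?U * ?V) - (mat_adjoint ?V * mat_adjoint ?U) * (Meas1 T d * (?U * ?V))"
    using Meas_carrier(1) UV by (subst mult_minus_distrib_mat[of _ d ?N _ d]) (auto intro!: carrier_matI)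
  also have "(mat_adjoint ?V * mat_adjoint ?U) * (?U * ?V) = mat_adjoint ?V * ((mat_adjoint ?U * ?U) * ?V)"
    by (simp add: mult_assoc_dim)
  also have "\<dots> = 1\<^sub>m d" using Ufwd_unitary' by (simp add: unitary_def anc_isometry)
  also have "(mat_adjoint ?V * mat_adjoint ?U) * (Meas1 T d * (?U * ?V)) = mat_adjoint ?L * ?L"
    by (simp add: miss_op_def Meas1_eq mat_adjoint_mult mult_assoc_dim)
  finally show "mat_adjoint ?V * sandwich T d \<phi> ks \<rho> (Meas2 T d) = (1\<^sub>m d - mat_adjoint ?L * ?L) * msqrt \<rho>" .
qed

text \<open>Both outcomes contribute positive operators, so the one that does not produce
  \<open>B\<close> may be dropped; \<open>ptrace_ge_anc\<close> bounds the other, and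
  \<open>anc_sandwich\<close> identifies it.\<close>

lemma out_state_ge:
  assumes v: "v \<in> carrier_vec d"
    and B: "B \<in> {mat_adjoint (miss_op T d \<phi> ks) * miss_op T d \<phi> ks,
      1\<^sub>m d - mat_adjoint (miss_op T d \<phi> ks) * miss_op T d \<phi> ks}"
  shows "vnorm2 (msqrt \<rho> *\<^sub>v (B *\<^sub>v v)) \<le> Re (cinner v (out_state T d \<phi> ks \<rho> *\<^sub>v v))"
proof -
  let ?p = "\<lambda>M. ptrace_anc T d (sandwich T d \<phi> ks \<rho> M * mat_adjoint (sandwich T d \<phi> ks \<rho> M))"
  note r = psdD[OF msqrt_props(1)[OF rho]]
  have Bd: "dim_row B = d" "dim_col B = d" and Badj: "mat_adjoint B = B"
    using B by (auto simp: mat_adjoint_minus mat_adjoint_mult)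
  have p: "psd d (?p M)" for M by (intro ptrace_mult_adjoint_psd) (simp add: dim_sandwich)
  have pc: "?p M \<in> carrier_mat d d" for M using p by (rule psdD)
  have split: "Re (cinner v (out_state T d \<phi> ks \<rho> *\<^sub>v v)) = Re (cinner v (?p (Meas1 T d) *\<^sub>v v)) + Re (cinner v (?p (Meas2 T d) *\<^sub>v v))"
    unfolding out_state_eq using v pc[THEN carrier_matD(1)]
    by (subst add_mult_distrib_mat_vec[OF pc pc v]) (simp add: cinner_add_right)
  obtain M where M: "M \<in> {Meas1 T d, Meas2 T d}" and eq: "mat_adjoint (anc T d) * sandwich T d \<phi> ks \<rho> M = B * msqrt \<rho>"
    using B anc_sandwich by blast
  have "vnorm2 (mat_adjoint (mat_adjoint (anc T d) * sandwich T d \<phi> ks \<rho> M) *\<^sub>v v) \<le> Re (cinner v (?p M *\<^sub>v v))"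
    using v by (intro ptrace_ge_anc) (simp_all add: dim_sandwich)
  moreover have "mat_adjoint (mat_adjoint (anc T d) * sandwich T d \<phi> ks \<rho> M) *\<^sub>v v = msqrt \<rho> *\<^sub>v (B *\<^sub>v v)"
    unfolding eq using v r Bd by (simp add: mat_adjoint_mult Badj mult_vec_assoc_dim)
  moreover have "Re (cinner v (?p M *\<^sub>v v)) \<le> Re (cinner v (out_state T d \<phi> ks \<rho> *\<^sub>v v))"
    unfolding split using M psdD(5)[OF p v, of "Meas1 T d"] psdD(5)[OF p v, of "Meas2 T d"] by auto
  ultimately show ?thesis by simp
qed

end

lemma chan_eq:
  "chan T d K \<phi> \<rho> = complex_of_real (1 / real (K ^ T)) \<cdot>\<^sub>m msum d (\<lambda>ks. out_state T d \<phi> ks \<rho>) (choices T K)"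
  by (simp add: chan_def msum_def out_state_def)


subsection \<open>The spectral gap\<close>

text \<open>\<open>Min\<close> is a lower bound only on a finite set, so finiteness of the spectrum
  has to be supplied; column \<open>i\<close> of \<open>U\<close> witnesses that \<open>a i\<close>
  is an eigenvalue.\<close>

lemma lambda_min_le:
  assumes U: "unitary n U" and i: "i < n" "a i \<noteq> 0"
  shows "lambda_min (spectral_mat n U a) \<le> a i"
proof -
  let ?A = "spectral_mat n U a"
  have A: "?A \<in> carrier_mat n n" by (simp add: carrier_matI dim_spectral_mat[OF U])
  have "finite (complex_of_real -` spectrum ?A)"
    by (intro finite_vimageI card_finite_spectrum(1)[OF A]) (simp add: inj_of_real)
  then have "finite {r. r \<noteq> 0 \<and> eigenvalue ?A (complex_of_real r)}"
    by (rule finite_subset[rotated]) (auto simp: spectrum_def)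
  moreover have "col U i \<noteq> 0\<^sub>v n"
    using cinner_col_unitary[OF U i(1) i(1)] cinner_self_eq_0[of "col U i"] by (auto simp: dim_unitary[OF U])
  then have "eigenvalue ?A (complex_of_real (a i))"
    using spectral_mat_eigen[OF U i(1), of a]
    by (auto simp: eigenvalue_def eigenvector_def dim_unitary[OF U] dim_spectral_mat[OF U]
        intro!: exI[of _ "col U i"] carrier_vecI)
  ultimately show ?thesis unfolding lambda_min_def using i(2) by (intro Min_le) auto
qed

text \<open>In the eigenbasis both sides are weighted sums of squared coordinates. Coordinates with
  eigenvalue 0, for which \<open>lambda_min\<close> gives no bound, vanish by hypothesis.\<close>

lemma lambda_min_mult_le:
  assumes U: "unitary n U" and v: "v \<in> carrier_vec n"
    and "\<And>i. i < n \<Longrightarrow> a i = 0 \<Longrightarrow> cinner (col U i) v = 0"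
  shows "lambda_min (spectral_mat n U a) * vnorm2 v \<le> Re (cinner v (spectral_mat n U a *\<^sub>v v))"
proof -
  have "lambda_min (spectral_mat n U a) * vnorm2 v
      = (\<Sum>i<n. lambda_min (spectral_mat n U a) * (cmod (cinner (col U i) v))\<^sup>2)"
    by (simp add: parseval[OF U v] sum_distrib_left)
  also have "\<dots> \<le> (\<Sum>i<n. a i * (cmod (cinner (col U i) v))\<^sup>2)"
  proof (rule sum_mono)
    fix i assume "i \<in> {..<n}"
    then show "lambda_min (spectral_mat n U a) * (cmod (cinner (col U i) v))\<^sup>2
        \<le> a i * (cmod (cinner (col U i) v))\<^sup>2"
      using assms(3)[of i] lambda_min_le[OF U, of i a] by (cases "a i = 0") (auto intro: mult_right_mono)
  qed
  finally show ?thesis by (simp add: cinner_spectral_mat[OF U v])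
qed

section \<open>Projections away from the given vectors and contraction on their span\<close>

definition proj_compl :: "nat \<Rightarrow> complex vec \<Rightarrow> complex mat" where
  "proj_compl d v = 1\<^sub>m d - outer v v"

context
  fixes d K :: nat and \<phi> :: "nat \<Rightarrow> complex vec"
  assumes K: "1 \<le> K" and unit: "\<And>k. k \<in> {1..K} \<Longrightarrow> unit_vec_c d (\<phi> k)"
begin

lemma dim_phi: "k \<in> {1..K} \<Longrightarrow> \<phi> k \<in> carrier_vec d" "k \<in> {1..K} \<Longrightarrow> dim_vec (\<phi> k) = d"
  using unit[of k] by (auto simp: unit_vec_c_def)

lemma cspan_carrier: "v \<in> cspan d \<phi> I \<Longrightarrow> v \<in> carrier_vec d"
  by (auto simp: cspan_def)

lemma phi_in_cspan: "k \<in> {1..K} \<Longrightarrow> \<phi> k \<in> cspan d \<phi> {1..K}"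
proof -
  assume k: "k \<in> {1..K}"
  have "(\<Sum>l\<in>{1..K}. (if l = k then 1 else 0) * \<phi> l $ i) = \<phi> k $ i" for i
    using k by (subst sum.remove[of _ k]) (auto intro!: sum.neutral)
  then have "\<phi> k = vec d (\<lambda>i. \<Sum>l\<in>{1..K}. (if l = k then 1 else 0) * (\<phi> l $ i))"
    using dim_phi[OF k] by (intro eq_vecI) auto
  then show ?thesis unfolding cspan_def by (intro CollectI exI[of _ "\<lambda>l. if l = k then 1 else 0"]) simp
qed

text \<open>Invariance of the span under a projection step, needed to iterate the contraction.
  Changing the coefficient of \<open>\<phi> k\<close> suffices, even if the vectors are linearly
  dependent.\<close>

lemma cspan_diff:
  assumes "v \<in> cspan d \<phi> {1..K}" "k \<in> {1..K}"
  shows "v - a \<cdot>\<^sub>v \<phi> k \<in> cspan d \<phi> {1..K}"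
proof -
  obtain c where c: "v = vec d (\<lambda>i. \<Sum>l\<in>{1..K}. c l * (\<phi> l $ i))" using assms(1) by (auto simp: cspan_def)
  have "(\<Sum>l\<in>{1..K}. (c(k := c k - a)) l * \<phi> l $ i) = (\<Sum>l\<in>{1..K}. c l * \<phi> l $ i) - a * \<phi> k $ i" for i
    using assms(2) by (simp add: sum.remove[of _ k] left_diff_distrib)
  then have "v - a \<cdot>\<^sub>v \<phi> k = vec d (\<lambda>i. \<Sum>l\<in>{1..K}. (c(k := c k - a)) l * (\<phi> l $ i))"
    using dim_phi[OF assms(2)] by (intro eq_vecI) (auto simp: c simp del: fun_upd_apply)
  then show ?thesis unfolding cspan_def by blast
qed

lemma cinner_cspan_eq_0:
  assumes "v \<in> cspan d \<phi> {1..K}" "dim_vec w = d" "\<And>k. k \<in> {1..K} \<Longrightarrow> cinner w (\<phi> k) = 0"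
  shows "cinner w v = 0"
proof -
  obtain c where c: "v = vec d (\<lambda>i. \<Sum>l\<in>{1..K}. c l * (\<phi> l $ i))" using assms(1) by (auto simp: cspan_def)
  have "cinner w v = (\<Sum>i<d. \<Sum>l\<in>{1..K}. c l * (cnj (w $ i) * \<phi> l $ i))"
    using assms(2) by (simp add: c cinner_sum sum_distrib_left mult_ac)
  also have "\<dots> = (\<Sum>l\<in>{1..K}. \<Sum>i<d. c l * (cnj (w $ i) * \<phi> l $ i))" by (rule sum.swap)
  also have "\<dots> = (\<Sum>l\<in>{1..K}. c l * cinner w (\<phi> l))"
    using assms(2) dim_phi(2) by (intro sum.cong) (auto simp: cinner_sum sum_distrib_left)
  also have "\<dots> = 0" using assms(3) by simp
  finally show ?thesis .
qed

lemma proj_compl_mult_vec: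
  "k \<in> {1..K} \<Longrightarrow> v \<in> carrier_vec d \<Longrightarrow> proj_compl d (\<phi> k) *\<^sub>v v = v - cinner (\<phi> k) v \<cdot>\<^sub>v \<phi> k"
  using dim_phi[of k]
  by (simp add: proj_compl_def minus_mult_distrib_mat_vec[of _ d d] outer_mult_vec carrier_matI)

text \<open>Pythagoras: the projected vector is orthogonal to the unit vector
  \<open>\<phi> k\<close>.\<close>

lemma vnorm2_proj_compl:
  assumes k: "k \<in> {1..K}" and v: "v \<in> carrier_vec d"
  shows "vnorm2 (proj_compl d (\<phi> k) *\<^sub>v v) = vnorm2 v - (cmod (cinner (\<phi> k) v))\<^sup>2"
proof -
  let ?p = "\<phi> k" let ?a = "cinner (\<phi> k) v"
  have p: "dim_vec ?p = d" "cinner ?p ?p = 1" using unit[OF k] by (auto simp: unit_vec_c_def)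
  let ?w = "v - ?a \<cdot>\<^sub>v ?p"
  have w: "dim_vec ?w = d" using v p by simp
  have "cinner ?p ?w = 0" using v p by (simp add: cinner_diff_right cinner_smult_right)
  then have "cinner ?w ?p = 0" using cinner_commute[of ?w ?p] p w by simp
  moreover have "cinner ?w ?w = cinner ?w v - ?a * cinner ?w ?p"
    using v p w by (subst cinner_diff_right) (auto simp: cinner_smult_right)
  moreover have "cinner ?w v = cnj (cinner v ?w)" using v w by (intro cinner_commute) auto
  moreover have "cinner v ?w = cinner v v - ?a * cinner v ?p"
    using v p by (subst cinner_diff_right) (auto simp: cinner_smult_right)
  moreover have "cinner v ?p = cnj ?a" using v p by (intro cinner_commute) auto
  ultimately have "complex_of_real (vnorm2 ?w) = complex_of_real (vnorm2 v - (cmod ?a)\<^sup>2)"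
    by (simp add: cinner_self complex_norm_square mult.commute del: of_real_power)
  then show ?thesis by (simp only: proj_compl_mult_vec[OF k v] of_real_eq_iff)
qed

lemma avg_proj_eq:
  "avg_proj d \<phi> K = complex_of_real (1 / real K) \<cdot>\<^sub>m msum d (\<lambda>k. outer (\<phi> k) (\<phi> k)) {1..K}"
  by (rule eq_matI) (auto simp: avg_proj_def msum_def)

lemma outer_psd: "k \<in> {1..K} \<Longrightarrow> psd d (outer (\<phi> k) (\<phi> k))"
proof -
  assume k: "k \<in> {1..K}"
  have "cinner v (outer (\<phi> k) (\<phi> k) *\<^sub>v v) = complex_of_real ((cmod (cinner (\<phi> k) v))\<^sup>2)" if v: "v \<in> carrier_vec d" for v
    using v dim_phi[OF k] cinner_commute[of v "\<phi> k"]
    by (simp add: outer_mult_vec cinner_smult_right complex_norm_square del: of_real_power)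
  then show ?thesis using dim_phi[OF k] by (auto simp: psd_def intro!: carrier_matI)
qed

lemma avg_proj_psd: "psd d (avg_proj d \<phi> K)"
  unfolding avg_proj_eq by (intro psd_smult psd_msum outer_psd) auto

lemma cinner_avg_proj:
  assumes v: "v \<in> carrier_vec d"
  shows "Re (cinner v (avg_proj d \<phi> K *\<^sub>v v)) = (\<Sum>k\<in>{1..K}. (cmod (cinner (\<phi> k) v))\<^sup>2) / real K"
proof -
  have "cinner v (avg_proj d \<phi> K *\<^sub>v v)
      = complex_of_real (1 / real K) * (\<Sum>k\<in>{1..K}. cinner v (outer (\<phi> k) (\<phi> k) *\<^sub>v v))"
  proof -
    have "cinner v (msum d (\<lambda>k. outer (\<phi> k) (\<phi> k)) {1..K} *\<^sub>v v)
        = (\<Sum>k\<in>{1..K}. cinner v (outer (\<phi> k) (\<phi> k) *\<^sub>v v))"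
      by (rule cinner_msum[OF v]) (rule psdD(1)[OF outer_psd])
    then show ?thesis unfolding avg_proj_eq using v by (subst cinner_smult_mat) (auto simp: carrier_matI)
  qed
  also have "\<dots> = complex_of_real (1 / real K) * (\<Sum>k\<in>{1..K}. complex_of_real ((cmod (cinner (\<phi> k) v))\<^sup>2))"
  proof -
    have "cinner v (outer (\<phi> k) (\<phi> k) *\<^sub>v v) = complex_of_real ((cmod (cinner (\<phi> k) v))\<^sup>2)" if "k \<in> {1..K}" for k
      using v dim_phi[OF that] cinner_commute[of v "\<phi> k"]
      by (simp add: outer_mult_vec cinner_smult_right complex_norm_square del: of_real_power)
    then show ?thesis by simp
  qed
  finally have "cinner v (avg_proj d \<phi> K *\<^sub>v v)
      = complex_of_real ((\<Sum>k\<in>{1..K}. (cmod (cinner (\<phi> k) v))\<^sup>2) / real K)" by simp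
  then show ?thesis by (simp only: Re_complex_of_real)
qed

text \<open>By Pythagoras the sum is \<open>K\<close> times the squared norm minus \<open>K\<close>
  times the expectation of \<open>avg_proj\<close>. A null eigenvector of \<open>avg_proj\<close> is
  orthogonal to every \<open>\<phi> k\<close>, hence to \<open>v\<close>, so the expectation is at
  least \<open>lambda_min\<close> times the squared norm.\<close>

lemma sum_vnorm2_proj_compl_le:
  assumes v: "v \<in> cspan d \<phi> {1..K}"
  shows "(\<Sum>k\<in>{1..K}. vnorm2 (proj_compl d (\<phi> k) *\<^sub>v v)) \<le> real K * (1 - lambda_min (avg_proj d \<phi> K)) * vnorm2 v"
proof -
  note vc = cspan_carrier[OF v]
  obtain U a where U: "unitary d U" and A: "avg_proj d \<phi> K = spectral_mat d U a"
    using psd_diagonalisation[OF avg_proj_psd] by blast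
  have "cinner (col U i) v = 0" if i: "i < d" "a i = 0" for i
  proof (rule cinner_cspan_eq_0[OF v])
    fix k assume k: "k \<in> {1..K}"
    have ci: "col U i \<in> carrier_vec d" by (simp add: carrier_vecI dim_unitary[OF U])
    have "(\<Sum>k\<in>{1..K}. (cmod (cinner (\<phi> k) (col U i)))\<^sup>2) / real K = 0"
      using cinner_spectral_mat_col[OF U i(1), of a] i(2) unfolding cinner_avg_proj[OF ci, symmetric] A by simp
    then have "(\<Sum>k\<in>{1..K}. (cmod (cinner (\<phi> k) (col U i)))\<^sup>2) = 0" using K by simp
    then have "cinner (\<phi> k) (col U i) = 0" using k by (subst (asm) sum_nonneg_eq_0_iff) auto
    then show "cinner (col U i) (\<phi> k) = 0"
      using cinner_commute[of "col U i" "\<phi> k"] dim_phi[OF k] dim_unitary[OF U] by simp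
  qed (simp add: dim_unitary[OF U])
  then have "lambda_min (avg_proj d \<phi> K) * vnorm2 v \<le> (\<Sum>k\<in>{1..K}. (cmod (cinner (\<phi> k) v))\<^sup>2) / real K"
    unfolding cinner_avg_proj[OF vc, symmetric] unfolding A using U vc by (intro lambda_min_mult_le)
  then have "real K * lambda_min (avg_proj d \<phi> K) * vnorm2 v \<le> (\<Sum>k\<in>{1..K}. (cmod (cinner (\<phi> k) v))\<^sup>2)"
    using K by (simp add: field_simps)
  moreover have "(\<Sum>k\<in>{1..K}. vnorm2 (proj_compl d (\<phi> k) *\<^sub>v v))
      = real K * vnorm2 v - (\<Sum>k\<in>{1..K}. (cmod (cinner (\<phi> k) v))\<^sup>2)"
    using vc by (simp add: vnorm2_proj_compl sum_subtractf)
  ultimately show ?thesis by (simp add: algebra_simps)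
qed

text \<open>The contraction estimate at the unit vector \<open>\<phi> 1\<close> has a nonnegative
  left side. The sign of \<open>1 - lambda_min\<close> is what allows later estimates to be
  multiplied by its powers.\<close>

lemma lambda_min_le_1: "lambda_min (avg_proj d \<phi> K) \<le> 1"
proof -
  have 1: "1 \<in> {1..K}" using K by simp
  have "vnorm2 (\<phi> 1) = 1" using unit[OF 1] by (simp add: unit_vec_c_def cinner_self)
  then have "(\<Sum>k\<in>{1..K}. vnorm2 (proj_compl d (\<phi> k) *\<^sub>v \<phi> 1)) \<le> real K * (1 - lambda_min (avg_proj d \<phi> K))"
    using sum_vnorm2_proj_compl_le[OF phi_in_cspan[OF 1]] by simp
  moreover have "0 \<le> (\<Sum>k\<in>{1..K}. vnorm2 (proj_compl d (\<phi> k) *\<^sub>v \<phi> 1))" by (intro sum_nonneg) simp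
  ultimately have "0 \<le> real K * (1 - lambda_min (avg_proj d \<phi> K))" by linarith
  then show ?thesis using K by (simp add: zero_le_mult_iff)
qed

section \<open>Averages over the random choices\<close>

lemma choices_unit: "ks \<in> choices T K \<Longrightarrow> j < T \<Longrightarrow> unit_vec_c d (\<phi> (ks ! j))"
  using nth_mem[of j ks] unfolding choices_def by (intro unit) blast

lemma choices_Suc: "choices (Suc T) K = (\<lambda>(k, ks). k # ks) ` ({1..K} \<times> choices T K)"
  by (auto simp: choices_def length_Suc_conv image_iff)

lemma choices_0: "choices 0 K = {[]}"
  by (auto simp: choices_def)

lemma finite_choices: "finite (choices T K)" and card_choices: "card (choices T K) = K ^ T"
proof -
  have "choices T K = {xs. set xs \<subseteq> {1..K} \<and> length xs = T}" by (auto simp: choices_def)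
  then show "finite (choices T K)" "card (choices T K) = K ^ T"
    by (simp_all add: finite_lists_length_eq card_lists_length_eq)
qed

lemma sum_choices_Suc: "(\<Sum>ks\<in>choices (Suc T) K. f ks) = (\<Sum>k\<in>{1..K}. \<Sum>ks\<in>choices T K. f (k # ks))"
proof -
  have "(\<Sum>ks\<in>choices (Suc T) K. f ks) = (\<Sum>p\<in>{1..K} \<times> choices T K. f ((\<lambda>(k, ks). k # ks) p))"
    unfolding choices_Suc by (subst sum.reindex) (auto simp: inj_on_def)
  also have "\<dots> = (\<Sum>k\<in>{1..K}. \<Sum>ks\<in>choices T K. f (k # ks))"
    by (subst sum.cartesian_product) (auto intro!: sum.cong)
  finally show ?thesis .
qed

lemma miss_op_Cons_vec:
  assumes "k \<in> {1..K}" "ks \<in> choices T K" "v \<in> carrier_vec d"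
  shows "miss_op (Suc T) d \<phi> (k # ks) *\<^sub>v v = miss_op T d \<phi> ks *\<^sub>v (proj_compl d (\<phi> k) *\<^sub>v v)"
proof -
  have "miss_op (Suc T) d \<phi> (k # ks) = miss_op T d \<phi> ks * proj_compl d (\<phi> k)"
    unfolding proj_compl_def
  proof (rule miss_op_Cons)
    fix j assume "j < Suc T"
    then show "unit_vec_c d (\<phi> ((k # ks) ! j))"
      using choices_unit[OF assms(2), of "j - 1"] unit[OF assms(1)] by (cases j) auto
  qed
  then show ?thesis using assms(3) dim_phi[OF assms(1)]
    by (simp add: mult_vec_assoc_dim proj_compl_def del: assoc_mult_mat_vec)
qed

text \<open>The first choice acts first, so the induction peels it off and uses the hypothesis at
  the projected vector, which stays in the span by \<open>cspan_diff\<close>; hence \<open>v\<close>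
  is arbitrary. Each step contributes one factor \<open>K * (1 - lambda_min)\<close>.\<close>

lemma sum_miss_op_le:
  assumes "v \<in> cspan d \<phi> {1..K}"
  shows "(\<Sum>ks\<in>choices T K. vnorm2 (miss_op T d \<phi> ks *\<^sub>v v))
    \<le> real K ^ T * (1 - lambda_min (avg_proj d \<phi> K)) ^ T * vnorm2 v"
  using assms
proof (induction T arbitrary: v)
  case 0
  then show ?case using cspan_carrier[OF 0] by (simp add: choices_0 miss_op_Nil)
next
  case (Suc T)
  note vc = cspan_carrier[OF Suc.prems]
  let ?g = "1 - lambda_min (avg_proj d \<phi> K)"
  have "(\<Sum>ks\<in>choices (Suc T) K. vnorm2 (miss_op (Suc T) d \<phi> ks *\<^sub>v v))
      = (\<Sum>k\<in>{1..K}. \<Sum>ks\<in>choices T K. vnorm2 (miss_op T d \<phi> ks *\<^sub>v (proj_compl d (\<phi> k) *\<^sub>v v)))"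
    unfolding sum_choices_Suc by (intro sum.cong refl) (simp add: miss_op_Cons_vec vc)
  also have "\<dots> \<le> (\<Sum>k\<in>{1..K}. real K ^ T * ?g ^ T * vnorm2 (proj_compl d (\<phi> k) *\<^sub>v v))"
    using cspan_diff[OF Suc.prems] by (intro sum_mono Suc.IH) (simp add: proj_compl_mult_vec vc)
  also have "\<dots> = real K ^ T * ?g ^ T * (\<Sum>k\<in>{1..K}. vnorm2 (proj_compl d (\<phi> k) *\<^sub>v v))"
    by (rule sum_distrib_left[symmetric])
  also have "\<dots> \<le> real K ^ T * ?g ^ T * (real K * ?g * vnorm2 v)"
    using lambda_min_le_1 by (intro mult_left_mono sum_vnorm2_proj_compl_le Suc.prems) auto
  finally show ?case by (simp add: mult_ac)
qed

lemma miss_op_orth: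
  assumes "v \<in> orth_compl d (cspan d \<phi> {1..K})" "ks \<in> choices T K"
  shows "miss_op T d \<phi> ks *\<^sub>v v = v"
  using assms(2)
proof (induction T arbitrary: ks)
  case 0
  then show ?case using assms(1) by (auto simp: choices_0 miss_op_Nil orth_compl_def)
next
  case (Suc T)
  then obtain k ks' where ks: "ks = k # ks'" "k \<in> {1..K}" "ks' \<in> choices T K" by (auto simp: choices_Suc)
  have v: "v \<in> carrier_vec d" using assms(1) by (auto simp: orth_compl_def)
  have "cinner (\<phi> k) v = 0" using assms(1) phi_in_cspan[OF ks(2)] by (auto simp: orth_compl_def)
  then have "proj_compl d (\<phi> k) *\<^sub>v v = v"
    unfolding proj_compl_mult_vec[OF ks(2) v] using v dim_phi[OF ks(2)] by (intro eq_vecI) auto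
  then show ?case unfolding ks(1) miss_op_Cons_vec[OF ks(2,3) v] using Suc.IH[OF ks(3)] by simp
qed

text \<open>Both bounds are averages of \<open>\<parallel>L e\<parallel>\<^sup>2\<close> over an eigenbasis of the system state,
  whose eigenvectors of nonzero weight lie in its support.\<close>

context
  fixes T :: nat and \<rho> U :: "complex mat" and p :: "nat \<Rightarrow> real"
  assumes U: "unitary d U" and rho_eq: "\<rho> = spectral_mat d U p" and p: "\<And>i. i < d \<Longrightarrow> 0 \<le> p i"
    and sum_p: "(\<Sum>i<d. p i) = 1"
begin

lemma state_psd: "psd d \<rho>"
  unfolding rho_eq using U p by (rule psd_spectral_mat)

lemma ctrace_miss_op:
  "ctrace (mat_adjoint (miss_op T d \<phi> ks) * miss_op T d \<phi> ks * \<rho>) =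
    complex_of_real (\<Sum>i<d. p i * vnorm2 (miss_op T d \<phi> ks *\<^sub>v col U i))"
proof -
  let ?L = "miss_op T d \<phi> ks"
  have [simp]: "dim_row \<rho> = d" "dim_col \<rho> = d" "dim_row U = d" "dim_col U = d"
    by (auto simp: rho_eq dim_spectral_mat[OF U] dim_unitary[OF U])
  have "ctrace (mat_adjoint ?L * ?L * \<rho>) = (\<Sum>i<d. cinner (col U i) ((mat_adjoint ?L * ?L * \<rho>) *\<^sub>v col U i))"
    by (rule ctrace_eq_sum_cinner[OF U]) (simp add: carrier_matI)
  also have "\<dots> = (\<Sum>i<d. complex_of_real (p i * vnorm2 (?L *\<^sub>v col U i)))"
  proof (rule sum.cong[OF refl])
    fix i assume "i \<in> {..<d}"
    then have i: "i < d" by simp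
    have ui: "col U i \<in> carrier_vec d" by (simp add: carrier_vecI)
    have "(mat_adjoint ?L * ?L * \<rho>) *\<^sub>v col U i = (mat_adjoint ?L * ?L) *\<^sub>v (complex_of_real (p i) \<cdot>\<^sub>v col U i)"
      using spectral_mat_eigen[OF U i, of p] by (subst mult_vec_assoc_dim) (auto simp: rho_eq dim_spectral_mat[OF U])
    also have "\<dots> = complex_of_real (p i) \<cdot>\<^sub>v ((mat_adjoint ?L * ?L) *\<^sub>v col U i)"
      by (rule mult_mat_vec[of _ d d]) (use ui in \<open>auto intro!: carrier_matI\<close>)
    also have "cinner (col U i) \<dots> = complex_of_real (p i) * cinner (col U i) ((mat_adjoint ?L * ?L) *\<^sub>v col U i)"
      by (rule cinner_smult_right) simp
    also have "cinner (col U i) ((mat_adjoint ?L * ?L) *\<^sub>v col U i) = cinner (?L *\<^sub>v col U i) (?L *\<^sub>v col U i)"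
      by (simp add: mult_vec_assoc_dim cinner_mult_mat_vec)
    finally show "cinner (col U i) ((mat_adjoint ?L * ?L * \<rho>) *\<^sub>v col U i)
        = complex_of_real (p i * vnorm2 (?L *\<^sub>v col U i))" by (simp add: cinner_self)
  qed
  finally show ?thesis by simp
qed

lemma ctrace_rho: "ctrace \<rho> = 1"
proof -
  have "ctrace \<rho> = (\<Sum>i<d. complex_of_real (p i))"
    using ctrace_eq_sum_cinner[OF U psdD(1)[OF state_psd]]
    by (simp add: rho_eq cinner_spectral_mat_col[OF U])
  then show ?thesis using sum_p by (simp flip: of_real_sum)
qed

text \<open>\<open>supp\<close> is the range, and an eigenvector of nonzero weight is the image of
  itself divided by the weight.\<close>

lemma eigvec_in_supp: "i < d \<Longrightarrow> p i \<noteq> 0 \<Longrightarrow> col U i \<in> supp d \<rho>"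
proof -
  assume i: "i < d" "p i \<noteq> 0"
  have ui: "col U i \<in> carrier_vec d" by (simp add: carrier_vecI dim_unitary[OF U])
  have "\<rho> *\<^sub>v (complex_of_real (1 / p i) \<cdot>\<^sub>v col U i) = complex_of_real (1 / p i) \<cdot>\<^sub>v (\<rho> *\<^sub>v col U i)"
    by (rule mult_mat_vec[OF psdD(1)[OF state_psd] ui])
  also have "\<dots> = col U i"
    using i spectral_mat_eigen[OF U i(1), of p] by (simp add: rho_eq smult_smult_assoc)
  finally have "col U i = \<rho> *\<^sub>v (complex_of_real (1 / p i) \<cdot>\<^sub>v col U i)" by simp
  then show ?thesis unfolding supp_def using ui
    by (intro CollectI exI[of _ "complex_of_real (1 / p i) \<cdot>\<^sub>v col U i"] conjI) auto
qed

lemma vnorm2_eigvec: "i < d \<Longrightarrow> vnorm2 (col U i) = 1"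
  using cinner_col_unitary[OF U, of i i] by (simp add: cinner_self)

lemma sum_miss_weight_le:
  assumes "supp d \<rho> \<subseteq> cspan d \<phi> {1..K}"
  shows "(\<Sum>ks\<in>choices T K. \<Sum>i<d. p i * vnorm2 (miss_op T d \<phi> ks *\<^sub>v col U i))
    \<le> real K ^ T * (1 - lambda_min (avg_proj d \<phi> K)) ^ T"
proof -
  let ?c = "real K ^ T * (1 - lambda_min (avg_proj d \<phi> K)) ^ T"
  have "(\<Sum>ks\<in>choices T K. \<Sum>i<d. p i * vnorm2 (miss_op T d \<phi> ks *\<^sub>v col U i))
      = (\<Sum>i<d. p i * (\<Sum>ks\<in>choices T K. vnorm2 (miss_op T d \<phi> ks *\<^sub>v col U i)))"
    by (subst sum.swap) (simp add: sum_distrib_left)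
  also have "\<dots> \<le> (\<Sum>i<d. p i * ?c)"
  proof (rule sum_mono)
    fix i assume "i \<in> {..<d}"
    then have i: "i < d" by simp
    show "p i * (\<Sum>ks\<in>choices T K. vnorm2 (miss_op T d \<phi> ks *\<^sub>v col U i)) \<le> p i * ?c"
    \<comment> \<open>An eigenvector of weight 0 may lie outside the support, but then its term
      vanishes.\<close>
    proof (cases "p i = 0")
      case False
      then have "col U i \<in> cspan d \<phi> {1..K}" using eigvec_in_supp[OF i] assms by blast
      from sum_miss_op_le[OF this, of T] show ?thesis
        using p[OF i] by (intro mult_left_mono) (simp_all add: vnorm2_eigvec[OF i])
    qed simp
  qed
  also have "\<dots> = ?c" using sum_p by (simp flip: sum_distrib_right)
  finally show ?thesis .
qed

lemma miss_weight_orth: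
  assumes "supp d \<rho> \<subseteq> orth_compl d (cspan d \<phi> {1..K})" "ks \<in> choices T K"
  shows "(\<Sum>i<d. p i * vnorm2 (miss_op T d \<phi> ks *\<^sub>v col U i)) = 1"
proof -
  have "(\<Sum>i<d. p i * vnorm2 (miss_op T d \<phi> ks *\<^sub>v col U i)) = (\<Sum>i<d. p i)"
  proof (rule sum.cong[OF refl])
    fix i assume "i \<in> {..<d}"
    then have i: "i < d" by simp
    show "p i * vnorm2 (miss_op T d \<phi> ks *\<^sub>v col U i) = p i"
    proof (cases "p i = 0")
      case False
      then have "col U i \<in> orth_compl d (cspan d \<phi> {1..K})" using eigvec_in_supp[OF i] assms by blast
      then show ?thesis using miss_op_orth[OF _ assms(2)] by (simp add: vnorm2_eigvec[OF i])
    qed simp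
  qed
  then show ?thesis using sum_p by simp
qed

lemma ctrace_Meas:
  assumes "ks \<in> choices T K"
  shows "Re (ctrace (Meas1 T d * state_after_i T d \<phi> ks \<rho>)) = (\<Sum>i<d. p i * vnorm2 (miss_op T d \<phi> ks *\<^sub>v col U i))"
    and "Re (ctrace (Meas2 T d * state_after_i T d \<phi> ks \<rho>)) = 1 - (\<Sum>i<d. p i * vnorm2 (miss_op T d \<phi> ks *\<^sub>v col U i))"
proof -
  note u = choices_unit[OF assms]
  show 1: "Re (ctrace (Meas1 T d * state_after_i T d \<phi> ks \<rho>)) = (\<Sum>i<d. p i * vnorm2 (miss_op T d \<phi> ks *\<^sub>v col U i))"
    using ctrace_Meas1[of T d \<phi> ks \<rho>, OF u state_psd] by (simp add: ctrace_miss_op)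
  show "Re (ctrace (Meas2 T d * state_after_i T d \<phi> ks \<rho>)) = 1 - (\<Sum>i<d. p i * vnorm2 (miss_op T d \<phi> ks *\<^sub>v col U i))"
    unfolding 1[symmetric] using ctrace_Meas2[of T d \<phi> ks \<rho>, OF u state_psd] by (simp add: ctrace_rho)
qed

lemma prob_Meas1_le:
  assumes "supp d \<rho> \<subseteq> cspan d \<phi> {1..K}"
  shows "prob_out T d K \<phi> (Meas1 T d) \<rho> \<le> (1 - lambda_min (avg_proj d \<phi> K)) ^ T"
proof -
  have "prob_out T d K \<phi> (Meas1 T d) \<rho>
      = (\<Sum>ks\<in>choices T K. \<Sum>i<d. p i * vnorm2 (miss_op T d \<phi> ks *\<^sub>v col U i)) / real K ^ T"
    by (simp add: prob_out_def ctrace_Meas)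
  also have "\<dots> \<le> real K ^ T * (1 - lambda_min (avg_proj d \<phi> K)) ^ T / real K ^ T"
    by (intro divide_right_mono sum_miss_weight_le assms) simp
  finally show ?thesis using K by simp
qed

text \<open>The error probability is exactly 0 here, because every \<open>miss_op\<close> fixes the
  support; it remains to see that the right side is nonnegative.\<close>

lemma prob_Meas2_le:
  assumes "supp d \<rho> \<subseteq> orth_compl d (cspan d \<phi> {1..K})"
  shows "prob_out T d K \<phi> (Meas2 T d) \<rho> \<le> (1 - lambda_min (avg_proj d \<phi> K)) ^ T"
proof -
  have "prob_out T d K \<phi> (Meas2 T d) \<rho> = 0"
    by (simp add: prob_out_def ctrace_Meas miss_weight_orth[OF assms])
  then show ?thesis using lambda_min_le_1 by simp
qed

text \<open>The outcome to keep may be chosen separately for each sequence. Averaging the bounds of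
  \<open>out_state_ge\<close> gives the domination that \<open>fidelity_ge_average\<close> asks
  for.\<close>

lemma chan_fidelity_ge:
  assumes B: "\<And>ks. ks \<in> choices T K \<Longrightarrow> B ks \<in> {mat_adjoint (miss_op T d \<phi> ks) * miss_op T d \<phi> ks,
      1\<^sub>m d - mat_adjoint (miss_op T d \<phi> ks) * miss_op T d \<phi> ks}"
  shows "(\<Sum>ks\<in>choices T K. Re (ctrace (B ks * \<rho>))) / real K ^ T \<le> fidelity (chan T d K \<phi> \<rho>) \<rho>"
proof -
  have out: "psd d (out_state T d \<phi> ks \<rho>)" if "ks \<in> choices T K" for ks
    by (rule psd_out_state) (auto intro: choices_unit[OF that] state_psd)
  have outc: "out_state T d \<phi> ks \<rho> \<in> carrier_mat d d" if "ks \<in> choices T K" for ks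
    by (rule psdD(1)[OF out[OF that]])
  have "(\<Sum>ks\<in>choices T K. Re (ctrace (B ks * \<rho>))) / card (choices T K) \<le> fidelity (chan T d K \<phi> \<rho>) \<rho>"
  proof (rule fidelity_ge_average)
    show "psd d (chan T d K \<phi> \<rho>)" unfolding chan_eq by (intro psd_smult psd_msum out) auto
    show "psd d \<rho>" by (rule state_psd)
    show "finite (choices T K)" by (rule finite_choices)
    show "choices T K \<noteq> {}" using K card_choices[of T] by auto
    show "B ks \<in> carrier_mat d d" "mat_adjoint (B ks) = B ks" if "ks \<in> choices T K" for ks
      using B[OF that] by (auto simp: mat_adjoint_minus mat_adjoint_mult intro!: carrier_matI)
    fix v :: "complex vec" assume v: "v \<in> carrier_vec d"
    have "(\<Sum>ks\<in>choices T K. vnorm2 (msqrt \<rho> *\<^sub>v (B ks *\<^sub>v v)))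
        \<le> (\<Sum>ks\<in>choices T K. Re (cinner v (out_state T d \<phi> ks \<rho> *\<^sub>v v)))"
    proof (rule sum_mono)
      fix ks assume ks: "ks \<in> choices T K"
      show "vnorm2 (msqrt \<rho> *\<^sub>v (B ks *\<^sub>v v)) \<le> Re (cinner v (out_state T d \<phi> ks \<rho> *\<^sub>v v))"
        by (rule out_state_ge[OF _ state_psd v B[OF ks]]) (rule choices_unit[OF ks])
    qed
    moreover have "Re (cinner v (chan T d K \<phi> \<rho> *\<^sub>v v))
        = (\<Sum>ks\<in>choices T K. Re (cinner v (out_state T d \<phi> ks \<rho> *\<^sub>v v))) / real (card (choices T K))"
    proof -
      have "cinner v (chan T d K \<phi> \<rho> *\<^sub>v v) = complex_of_real (1 / real (K ^ T)) *
          cinner v (msum d (\<lambda>ks. out_state T d \<phi> ks \<rho>) (choices T K) *\<^sub>v v)"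
        unfolding chan_eq using v by (intro cinner_smult_mat) (auto intro: carrier_matI)
      also have "cinner v (msum d (\<lambda>ks. out_state T d \<phi> ks \<rho>) (choices T K) *\<^sub>v v)
          = (\<Sum>ks\<in>choices T K. cinner v (out_state T d \<phi> ks \<rho> *\<^sub>v v))"
        by (rule cinner_msum[OF v outc])
      finally have "Re (cinner v (chan T d K \<phi> \<rho> *\<^sub>v v)) = Re (complex_of_real (1 / real (K ^ T)) *
          (\<Sum>ks\<in>choices T K. cinner v (out_state T d \<phi> ks \<rho> *\<^sub>v v)))" by (rule arg_cong)
      moreover have "Re (complex_of_real a * z) = a * Re z" for a z by simp
      ultimately show ?thesis by (simp only: card_choices Re_sum times_divide_eq_left mult_1)
    qed
    ultimately show "(\<Sum>ks\<in>choices T K. vnorm2 (msqrt \<rho> *\<^sub>v (B ks *\<^sub>v v))) / real (card (choices T K))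
        \<le> Re (cinner v (chan T d K \<phi> \<rho> *\<^sub>v v))"
      by (simp add: divide_right_mono)
  qed
  then show ?thesis by (simp add: card_choices)
qed

text \<open>The second outcome is the correct one, so its operator is kept. Its trace against
  \<open>\<rho>\<close> is one minus the weight of a miss, whose average is bounded by
  \<open>sum_miss_weight_le\<close>.\<close>

lemma fidelity_cspan:
  assumes "supp d \<rho> \<subseteq> cspan d \<phi> {1..K}"
  shows "1 - (1 - lambda_min (avg_proj d \<phi> K)) ^ T \<le> fidelity (chan T d K \<phi> \<rho>) \<rho>"
proof -
  let ?N = "\<lambda>ks. mat_adjoint (miss_op T d \<phi> ks) * miss_op T d \<phi> ks"
  let ?q = "\<lambda>ks. \<Sum>i<d. p i * vnorm2 (miss_op T d \<phi> ks *\<^sub>v col U i)"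
  note rho = psdD[OF state_psd]
  have "Re (ctrace ((1\<^sub>m d - ?N ks) * \<rho>)) = 1 - ?q ks" for ks
  proof -
    have "(1\<^sub>m d - ?N ks) * \<rho> = \<rho> - ?N ks * \<rho>"
      using rho(1) by (subst minus_mult_distrib_mat[of _ d d _ _ d]) (auto intro!: carrier_matI)
    then show ?thesis using rho by (simp add: ctrace_minus ctrace_miss_op ctrace_rho)
  qed
  then have "(\<Sum>ks\<in>choices T K. 1 - ?q ks) / real K ^ T \<le> fidelity (chan T d K \<phi> \<rho>) \<rho>"
    using chan_fidelity_ge[of "\<lambda>ks. 1\<^sub>m d - ?N ks"] by simp
  moreover have "(\<Sum>ks\<in>choices T K. 1 - ?q ks) / real K ^ T = 1 - (\<Sum>ks\<in>choices T K. ?q ks) / real K ^ T"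
    using K by (simp add: sum_subtractf card_choices diff_divide_distrib)
  moreover have "(\<Sum>ks\<in>choices T K. ?q ks) / real K ^ T
      \<le> real K ^ T * (1 - lambda_min (avg_proj d \<phi> K)) ^ T / real K ^ T"
    by (intro divide_right_mono sum_miss_weight_le assms) simp
  ultimately show ?thesis using K by simp
qed

text \<open>The first outcome is kept. It occurs with probability 1, which already makes the
  fidelity at least 1.\<close>

lemma fidelity_orth:
  assumes "supp d \<rho> \<subseteq> orth_compl d (cspan d \<phi> {1..K})"
  shows "1 - (1 - lambda_min (avg_proj d \<phi> K)) ^ T \<le> fidelity (chan T d K \<phi> \<rho>) \<rho>"
proof -
  have "(\<Sum>ks\<in>choices T K. Re (ctrace (mat_adjoint (miss_op T d \<phi> ks) * miss_op T d \<phi> ks * \<rho>))) / real K ^ T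
      \<le> fidelity (chan T d K \<phi> \<rho>) \<rho>"
    by (rule chan_fidelity_ge) simp
  then have "1 \<le> fidelity (chan T d K \<phi> \<rho>) \<rho>"
    using K by (simp add: ctrace_miss_op miss_weight_orth[OF assms] card_choices)
  moreover have "0 \<le> (1 - lambda_min (avg_proj d \<phi> K)) ^ T" using lambda_min_le_1 by simp
  ultimately show ?thesis by linarith
qed

end

end

theorem theorem4:
  fixes d K T :: nat and \<phi> :: "nat \<Rightarrow> complex vec" and \<rho> :: "complex mat"
  assumes "d > 0" and "K \<ge> 1"
    and "\<forall>k\<in>{1..K}. unit_vec_c d (\<phi> k)"
    and "density d \<rho>"
    and "supp d \<rho> \<subseteq> cspan d \<phi> {1..K} \<or> supp d \<rho> \<subseteq> orth_compl d (cspan d \<phi> {1..K})"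
  shows "(supp d \<rho> \<subseteq> cspan d \<phi> {1..K} \<longrightarrow>
            prob_out T d K \<phi> (Meas1 T d) \<rho> \<le> (1 - lambda_min (avg_proj d \<phi> K)) ^ T)
       \<and> (supp d \<rho> \<subseteq> orth_compl d (cspan d \<phi> {1..K}) \<longrightarrow>
            prob_out T d K \<phi> (Meas2 T d) \<rho> \<le> (1 - lambda_min (avg_proj d \<phi> K)) ^ T)
       \<and> fidelity (chan T d K \<phi> \<rho>) \<rho> \<ge> 1 - (1 - lambda_min (avg_proj d \<phi> K)) ^ T"
proof -
  have unit: "\<And>k. k \<in> {1..K} \<Longrightarrow> unit_vec_c d (\<phi> k)" using assms(3) by blast
  have rho: "psd d \<rho>" and tr: "ctrace \<rho> = 1" using assms(4) by (auto simp: density_def)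
  \<comment> \<open>An eigenbasis of \<open>\<rho>\<close> supplies the data of the context above;
    trace 1 makes the weights \<open>p\<close> a probability distribution.\<close>
  obtain U p where U: "unitary d U" and rp: "\<rho> = spectral_mat d U p" and p: "\<And>i. i < d \<Longrightarrow> 0 \<le> p i"
    using psd_diagonalisation[OF rho] by blast
  have "ctrace \<rho> = (\<Sum>i<d. complex_of_real (p i))"
    using ctrace_eq_sum_cinner[OF U psdD(1)[OF rho]] by (simp add: rp cinner_spectral_mat_col[OF U])
  then have sp: "(\<Sum>i<d. p i) = 1" using tr by (metis of_real_eq_1_iff of_real_sum)
  note facts = prob_Meas1_le prob_Meas2_le fidelity_cspan fidelity_orth
  note facts' = facts[of K d \<phi> U \<rho> p T, OF assms(2) unit U rp p sp]
  show ?thesis using assms(5) facts' by blast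
qed

end
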